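(* Let $G^{\mathfrak C}$ be a coupled graph of order $2p$ such that $\operatorname{M}_{\operatorname{Sp}}(G^{\mathfrak C})=1$. Then $G^{\mathfrak C}$ allows a multiset of $p$ positive real numbers as a symplectic spectrum if and only if its elements are distinct. In particular, this applies to every caterpillar that contains a perfect matching, with the coupling defined by the perfect matching.
   Context: $\Omega=\begin{bmatrix}O&I_p\\-I_p&O\end{bmatrix}$; a real $2p\times2p$ matrix $S$ is symplectic if $S^\top\Omega S=\Omega$. Positive definite matrices are real symmetric. By Williamson's theorem, for each $2p\times 2p$ positive definite $N$ there is a symplectic $S$ with $S^\top NS=D\oplus D$, $D$ a $p\times p$ diagonal matrix whose diagonal entries are positive and unique up to order; the multiset of these is the symplectic spectrum of $N$, and the multiplicity of a symplectic eigenvalue is its number of occurrences on the diagonal of $D$. Graphs are simple, undirected, finite. A coupled graph $G^{\mathfrak C}$ is a graph $G$ of order $2p$ together with a coupling $\mathfrak C$, i.e. a partition of $V(G)$ into $p$ unordered pairs (paired vertices need not be adjacent). A representative labeling $L$ of $G^{\mathfrak C}$ is a bijective labeling of $V(G)$ by $1,\dots,2p$ such that each pair of $\mathfrak C$ receives labels $\{k,k+p\}$ for some $k\in\{1,\dots,p\}$. $\mathcal S_+(G^L)$ is the set of positive definite matrices $[n_{ij}]$ such that for $i\neq j$, $n_{ij}\ne0$ if and only if the vertices labeled $i$ and $j$ are adjacent. $G^{\mathfrak C}$ allows a multiset $\Lambda$ of $p$ positive reals as a symplectic spectrum if there are a representative labeling $L$ and $N\in\mathcal S_+(G^L)$ with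 symplectic spectrum $\Lambda$. $\operatorname{M}_{\operatorname{Sp}}(G^{\mathfrak C})$ is the maximum multiplicity among the symplectic eigenvalues of matrices $N\in\mathcal S_+(G^L)$, for a representative labeling $L$ (independent of the choice of $L$). A caterpillar is a tree $T$ that has a path $P$ such that every other vertex of $T$ is adjacent to a vertex of $P$. The coupling defined by a perfect matching $M$ consists of the pairs of endpoints of the edges of $M$. *)

theory Defs
  imports
    "HOL-Library.Multiset"
    "HOL-Library.Disjoint_Sets"
    "Graph_Theory.Graph_Theory"
    "Jordan_Normal_Form.Matrix"
begin

definition Omega :: "nat \<Rightarrow> real mat" where
  "Omega p = four_block_mat (0\<^sub>m p p) (1\<^sub>m p) (- 1\<^sub>m p) (0\<^sub>m p p)"

definition symplectic :: "nat \<Rightarrow> real mat \<Rightarrow> bool" where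
  "symplectic p S \<longleftrightarrow>
    S \<in> carrier_mat (2 * p) (2 * p) \<and> transpose_mat S * Omega p * S = Omega p"

definition positive_definite :: "nat \<Rightarrow> real mat \<Rightarrow> bool" where
  "positive_definite n N \<longleftrightarrow>
    N \<in> carrier_mat n n \<and> transpose_mat N = N \<and>
    (\<forall>x \<in> carrier_vec n. x \<noteq> 0\<^sub>v n \<longrightarrow> x \<bullet> (N *\<^sub>v x) > 0)"

(* A relation rather than a function of N; by Williamson's theorem every positive definite
   2p x 2p matrix N is related to exactly one multiset. *)
definition has_symplectic_spectrum :: "nat \<Rightarrow> real mat \<Rightarrow> real multiset \<Rightarrow> bool" where
  "has_symplectic_spectrum p N \<Lambda> \<longleftrightarrow>
    (\<exists>S D. symplectic p S \<and> D \<in> carrier_mat p p \<and> diagonal_mat D \<and> (\<forall>i<p. D $$ (i, i) > 0) \<and>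
      transpose_mat S * N * S = four_block_mat D (0\<^sub>m p p) (0\<^sub>m p p) D \<and>
      \<Lambda> = mset (diag_mat D))"

(* Finite simple undirected graphs are rendered by the library locale pair_graph: every edge uv
   is the pair of arcs (u, v), (v, u). *)
definition coupled_graph :: "nat \<Rightarrow> 'v pair_pre_digraph \<Rightarrow> 'v set set \<Rightarrow> bool" where
  "coupled_graph p G C \<longleftrightarrow>
    pair_graph G \<and> card (pverts G) = 2 * p \<and>
    partition_on (pverts G) C \<and> (\<forall>c \<in> C. card c = 2)"

(* Labels are 0, ..., 2p - 1 instead of 1, ..., 2p, since matrix indices start at 0. *)
definition representative_labeling ::
    "nat \<Rightarrow> 'v pair_pre_digraph \<Rightarrow> 'v set set \<Rightarrow> ('v \<Rightarrow> nat) \<Rightarrow> bool" where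
  "representative_labeling p G C L \<longleftrightarrow>
    bij_betw L (pverts G) {..<2 * p} \<and> (\<forall>c \<in> C. \<exists>k<p. L ` c = {k, k + p})"

definition S_plus :: "nat \<Rightarrow> 'v pair_pre_digraph \<Rightarrow> ('v \<Rightarrow> nat) \<Rightarrow> real mat set" where
  "S_plus p G L =
    {N. positive_definite (2 * p) N \<and>
        (\<forall>u \<in> pverts G. \<forall>v \<in> pverts G. u \<noteq> v \<longrightarrow>
           (N $$ (L u, L v) \<noteq> 0 \<longleftrightarrow> (u, v) \<in> parcs G))}"

definition allows_symplectic_spectrum ::
    "nat \<Rightarrow> 'v pair_pre_digraph \<Rightarrow> 'v set set \<Rightarrow> real multiset \<Rightarrow> bool" where
  "allows_symplectic_spectrum p G C \<Lambda> \<longleftrightarrow>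
    (\<exists>L N. representative_labeling p G C L \<and> N \<in> S_plus p G L \<and> has_symplectic_spectrum p N \<Lambda>)"

(* The maximum is over all representative labelings; each single one yields the same value.
   The set is finite since multiplicities are at most p; it is nonempty for p > 0. *)
definition M_Sp :: "nat \<Rightarrow> 'v pair_pre_digraph \<Rightarrow> 'v set set \<Rightarrow> nat" where
  "M_Sp p G C =
    Max {count \<Lambda> x | L N \<Lambda> x. representative_labeling p G C L \<and> N \<in> S_plus p G L \<and>
           has_symplectic_spectrum p N \<Lambda> \<and> x \<in># \<Lambda>}"

(* The library's own predicate tree does not fit undirected graphs: there the two arcs of an edge
   form a cycle of length 2, so cycles are required to have length at least 3 here. *)
definition undirected_tree :: "'v pair_pre_digraph \<Rightarrow> bool" where
  "undirected_tree G \<longleftrightarrow>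
    pair_graph G \<and> Digraph_Component.connected (with_proj G) \<and>
    \<not> (\<exists>c. pre_digraph.cycle (with_proj G) c \<and> length c \<ge> 3)"

definition caterpillar :: "'v pair_pre_digraph \<Rightarrow> bool" where
  "caterpillar G \<longleftrightarrow>
    undirected_tree G \<and>
    (\<exists>P. vpath P (with_proj G) \<and>
         (\<forall>v \<in> pverts G - set P. \<exists>u \<in> set P. (v, u) \<in> parcs G))"

(* Edges of the matching are given as their sets of endpoints, so that the coupling defined by a
   perfect matching M is M itself. *)
definition perfect_matching :: "'v pair_pre_digraph \<Rightarrow> 'v set set \<Rightarrow> bool" where
  "perfect_matching G M \<longleftrightarrow>
    M \<subseteq> {{u, v} | u v. (u, v) \<in> parcs G} \<and> (\<forall>v \<in> pverts G. \<exists>!e. e \<in> M \<and> v \<in> e)"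

end

theory Submission
  imports Defs "HOL-Analysis.Brouwer_Fixpoint" "HOL-Analysis.Function_Metric"
    "Jordan_Normal_Form.Determinant"
begin

text \<open>
  A positive number \<open>l\<close> is a symplectic eigenvalue of a positive definite matrix \<open>N\<close> iff the Hermitian
  matrix \<open>H = N + \<i> l \<Omega>\<close> is singular, and the multiplicity of \<open>l\<close> is at most the dimension of the
  kernel of \<open>H\<close>. Both halves of the result come from this description.

  Every coupled graph allows every multiset of \<open>p\<close> distinct positive numbers \<open>l\<^sub>1, \<dots>, l\<^sub>p\<close>
  (\<open>coupled_graph_allows_distinct_spectrum\<close>). Consider matrices with diagonal \<open>(d, d)\<close> and a common
  weight \<open>e\<close> on all edges. Without edges, \<open>d = (l\<^sub>1, \<dots>, l\<^sub>p)\<close> solves the \<open>p\<close> real equations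
  \<open>det (N + \<i> l\<^sub>j \<Omega>) = 0\<close>, and it is a zero of the kind that cannot disappear under a small
  perturbation: in direction \<open>j\<close> the \<open>j\<close>-th equation changes sign across a small box. The
  Poincare-Miranda theorem (\<open>poincare_miranda\<close>), an intermediate value theorem in \<open>p\<close> dimensions,
  yields a solution \<open>d\<close> also for small \<open>e > 0\<close> (\<open>distinct_symplectic_spectrum_realizable\<close>). As the
  \<open>l\<^sub>j\<close> are distinct, the kernel vectors found for them are symplectically orthogonal and assemble to
  a symplectic matrix (\<open>Williamson_distinct\<close>). Conversely, if the maximum multiplicity is \<open>1\<close>, an
  allowed multiset has distinct elements by definition.

  For a caterpillar coupled by a perfect matching, the matrix \<open>H\<close> has the pattern of the caterpillar,
  because \<open>\<Omega>\<close> has its nonzero entries at matched pairs, which are edges. The diagonal of \<open>H\<close> is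
  positive. Following the spine, a kernel vector of \<open>H\<close> that vanishes at the first spine vertex
  vanishes everywhere (\<open>caterpillar_kernel_vector\<close>), so the kernel is at most one-dimensional and all
  multiplicities are \<open>1\<close> (\<open>multiplicity_le_1I\<close>, \<open>caterpillar_multiplicity_le_1\<close>).
\<close>

unbundle no inner_syntax
unbundle no vec_syntax
hide_const (open) Finite_Cartesian_Product.mat Finite_Cartesian_Product.row Finite_Cartesian_Product.vec
hide_type (open) Finite_Cartesian_Product.vec

section \<open>An intermediate value theorem on boxes\<close>

lemma compact_box_fun:
  fixes a b :: "nat \<Rightarrow> real"
  shows "compact {x. \<forall>i. x i \<in> {a i..b i}}"
proof -
  have "compactin (product_topology (\<lambda>i::nat. (euclidean :: real topology)) UNIV) (PiE UNIV (\<lambda>i. {a i..b i}))"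
    by (simp add: compactin_PiE)
  moreover have "PiE UNIV (\<lambda>i. {a i..b i}) = {x. \<forall>i. x i \<in> {a i..b i}}"
    by (auto simp: PiE_def Pi_def)
  ultimately show ?thesis
    by (simp add: euclidean_product_topology)
qed

lemma tendsto_fun_iff:
  fixes x :: "nat \<Rightarrow> nat \<Rightarrow> real"
  shows "(x \<longlonglongrightarrow> l) \<longleftrightarrow> (\<forall>i. (\<lambda>m. x m i) \<longlonglongrightarrow> l i)"
  using limitin_componentwise[of "\<lambda>_. euclidean" UNIV x l sequentially]
  by (simp add: euclidean_product_topology limitin_canonical_iff)

text \<open>The intermediate value theorem in \<open>n\<close> dimensions. On a grid of mesh \<open>1 / m\<close> label a point in
  direction \<open>i\<close> by the sign of \<open>f i\<close>; Kuhn's combinatorial lemma gives a grid cell on whose corners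
  every \<open>f i\<close> takes both signs, and a limit point of such cells for \<open>m \<rightarrow> \<infinity>\<close> is a common zero.
  The arguments are functions on the naturals rather than vectors of a Euclidean space, because the
  dimension \<open>n\<close> will be the number of pairs of a coupling, which is not tied to a type.\<close>

lemma poincare_miranda:
  fixes f :: "nat \<Rightarrow> (nat \<Rightarrow> real) \<Rightarrow> real" and a b :: "nat \<Rightarrow> real"
  defines "K \<equiv> {x. \<forall>i. x i \<in> {a i..b i}}"
  assumes ab: "\<And>i. a i \<le> b i"
    and cont: "\<And>i. i < n \<Longrightarrow> continuous_on K (f i)"
    and low: "\<And>i x. i < n \<Longrightarrow> x \<in> K \<Longrightarrow> x i = a i \<Longrightarrow> f i x \<le> 0"
    and high: "\<And>i x. i < n \<Longrightarrow> x \<in> K \<Longrightarrow> x i = b i \<Longrightarrow> f i x \<ge> 0"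
  shows "\<exists>x\<in>K. \<forall>i<n. f i x = 0"
proof -
  define g where "g m x = (\<lambda>i. if i < n then a i + (b i - a i) * (real (x i) / real m) else a i)"
    for m :: nat and x :: "nat \<Rightarrow> nat"
  have compK: "compact K" unfolding K_def by (rule compact_box_fun)
  have gK: "g m x \<in> K" if "m > 0" "\<forall>i<n. x i \<le> m" for m x
  proof -
    have "(b i - a i) * (real (x i) / real m) \<le> (b i - a i) * 1" if "i < n" for i
      using \<open>\<forall>i<n. x i \<le> m\<close> \<open>m > 0\<close> that ab[of i] by (intro mult_left_mono) auto
    moreover have "0 \<le> (b i - a i) * (real (x i) / real m)" for i
      using ab[of i] by simp
    ultimately show ?thesis
      unfolding K_def g_def using ab by fastforce
  qed
  define near where "near m z r \<longleftrightarrow> r \<in> K \<and> (\<forall>j. \<bar>r j - z j\<bar> \<le> (b j - a j) / real m)"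
    for m :: nat and z r :: "nat \<Rightarrow> real"
  have "\<exists>z\<in>K. \<forall>i<n. \<exists>r s. near m z r \<and> near m z s \<and> f i r \<le> 0 \<and> 0 \<le> f i s"
    if m: "m > 0" for m :: nat
  proof -
    \<comment> \<open>Points of the faces get the label that Kuhn's lemma demands even where \<open>f i\<close> vanishes.\<close>
    define label :: "(nat \<Rightarrow> nat) \<Rightarrow> nat \<Rightarrow> nat" where
      "label x i = (if x i = 0 then 0 else if x i = m then 1 else if f i (g m x) \<le> 0 then 0 else 1)"
      for x i
    have lab: "label x i = 0 \<and> f i (g m x) \<le> 0 \<or> label x i = 1 \<and> f i (g m x) \<ge> 0"
      if "\<forall>i<n. x i \<le> m" "i < n" for x i
    proof -
      have "f i (g m x) \<le> 0" if "x i = 0"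
        using low[OF \<open>i < n\<close> gK[OF m \<open>\<forall>i<n. x i \<le> m\<close>]] that \<open>i < n\<close> by (simp add: g_def)
      moreover have "f i (g m x) \<ge> 0" if "x i = m"
        using high[OF \<open>i < n\<close> gK[OF m \<open>\<forall>i<n. x i \<le> m\<close>]] that \<open>i < n\<close> m by (simp add: g_def)
      ultimately show ?thesis by (auto simp: label_def)
    qed
    obtain q where q: "\<forall>i<n. q i < m" and
      qs: "\<forall>i<n. \<exists>r s. (\<forall>j<n. q j \<le> r j \<and> r j \<le> q j + 1) \<and> (\<forall>j<n. q j \<le> s j \<and> s j \<le> q j + 1) \<and>
              label r i \<noteq> label s i"
    proof (rule kuhn_lemma[of m n label])
      show "\<forall>x. (\<forall>i<n. x i \<le> m) \<longrightarrow> (\<forall>i<n. label x i = 0 \<or> label x i = 1)"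
        by (simp add: label_def)
    qed (use m in \<open>auto simp: label_def\<close>)
    have close: "\<bar>g m r j - g m q j\<bar> \<le> (b j - a j) / real m"
      if "\<forall>j<n. q j \<le> r j \<and> r j \<le> q j + 1" for r j
    proof (cases "j < n")
      case True
      then have "real (r j) - real (q j) \<le> 1" "0 \<le> real (r j) - real (q j)"
        using that by force+
      then have "\<bar>(b j - a j) * (real (r j) - real (q j))\<bar> \<le> (b j - a j) * 1"
        using ab[of j] by (simp add: abs_mult mult_left_le)
      moreover have "g m r j - g m q j = (b j - a j) * (real (r j) - real (q j)) / real m"
        using True by (simp add: g_def field_simps add_divide_distrib diff_divide_distrib)
      ultimately show ?thesis using m by (simp add: divide_right_mono)
    qed (use ab m in \<open>simp add: g_def\<close>)
    show ?thesis
    proof (rule bexI[of _ "g m q"], intro allI impI)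
      show "g m q \<in> K" using gK[OF m] q by (simp add: less_imp_le)
      fix i assume i: "i < n"
      obtain r s where rs: "\<forall>j<n. q j \<le> r j \<and> r j \<le> q j + 1" "\<forall>j<n. q j \<le> s j \<and> s j \<le> q j + 1"
        "label r i \<noteq> label s i" using qs i by blast
      have "\<forall>j<n. r j \<le> m" "\<forall>j<n. s j \<le> m" using rs q by (fastforce simp: Suc_le_eq)+
      then have "near m (g m q) (g m r)" "near m (g m q) (g m s)"
        using gK[OF m] close[OF rs(1)] close[OF rs(2)] by (auto simp: near_def)
      then show "\<exists>r s. near m (g m q) r \<and> near m (g m q) s \<and> f i r \<le> 0 \<and> 0 \<le> f i s"
        using lab[of r i] lab[of s i] rs(3) i \<open>\<forall>j<n. r j \<le> m\<close> \<open>\<forall>j<n. s j \<le> m\<close> by metis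
    qed
  qed
  then have "\<forall>m. \<exists>z. z \<in> K \<and> (\<forall>i<n. \<exists>r s. near (Suc m) z r \<and> near (Suc m) z s \<and> f i r \<le> 0 \<and> 0 \<le> f i s)"
    by blast
  from choice[OF this] obtain z where zK: "\<And>m. z m \<in> K" and
    z: "\<And>m i. i < n \<Longrightarrow> \<exists>r s. near (Suc m) (z m) r \<and> near (Suc m) (z m) s \<and> f i r \<le> 0 \<and> 0 \<le> f i s"
    by blast
  obtain l \<sigma> where l: "l \<in> K" and \<sigma>: "strict_mono \<sigma>" and lim: "(z \<circ> \<sigma>) \<longlonglongrightarrow> l"
    using seq_compactE[OF compact_imp_seq_compact[OF compK], of z] zK by blast
  have "f i l = 0" if i: "i < n" for i
  proof -
    have "\<forall>m. \<exists>r. near (Suc m) (z m) r \<and> f i r \<le> 0"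
      using z[OF i] by blast
    from choice[OF this] obtain r where r: "\<And>m. near (Suc m) (z m) (r m)" "\<And>m. f i (r m) \<le> 0"
      by blast
    have "\<forall>m. \<exists>s. near (Suc m) (z m) s \<and> 0 \<le> f i s"
      using z[OF i] by blast
    from choice[OF this] obtain s where s: "\<And>m. near (Suc m) (z m) (s m)" "\<And>m. 0 \<le> f i (s m)"
      by blast
    have fconv: "(\<lambda>m. f i (t (\<sigma> m))) \<longlonglongrightarrow> f i l" if t: "\<And>m. near (Suc m) (z m) (t m)" for t
    proof -
      have "(t \<circ> \<sigma>) \<longlonglongrightarrow> l"
        unfolding tendsto_fun_iff
      proof
        fix j
        have "(\<lambda>m. (b j - a j) / real (Suc m)) \<longlonglongrightarrow> 0"
          by (rule LIMSEQ_Suc[OF lim_const_over_n])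
        then have "(\<lambda>m. t m j - z m j) \<longlonglongrightarrow> 0"
          by (rule Lim_null_comparison[rotated]) (use t in \<open>simp add: near_def\<close>)
        from tendsto_add[OF LIMSEQ_subseq_LIMSEQ[OF this \<sigma>], of "\<lambda>m. (z \<circ> \<sigma>) m j" "l j"]
        show "(\<lambda>m. (t \<circ> \<sigma>) m j) \<longlonglongrightarrow> l j"
          using lim[unfolded tendsto_fun_iff] by (simp add: o_def)
      qed
      from continuous_on_tendsto_compose[OF cont[OF i] this l] show ?thesis
        using t by (simp add: near_def o_def)
    qed
    show ?thesis
      using LIMSEQ_le_const2[OF fconv[OF r(1)], of 0] LIMSEQ_le_const[OF fconv[OF s(1)], of 0]
        r(2) s(2) by fastforce
  qed
  then show ?thesis using l by blast
qed

text \<open>The tube lemma for a strict inequality: the parameters at which it fails somewhere on \<open>K\<close> form a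
  compact set, as a projection of a compact set, and this set misses \<open>0\<close>.\<close>

lemma eventually_positive_on_compact:
  fixes g :: "'a::metric_space \<times> real \<Rightarrow> real"
  assumes K: "compact K" and cont: "continuous_on (K \<times> {0..1}) g" and pos: "\<And>x. x \<in> K \<Longrightarrow> g (x, 0) > 0"
  shows "\<forall>\<^sub>F e in at_right 0. \<forall>x\<in>K. g (x, e) > 0"
proof -
  define S where "S = {z \<in> K \<times> {0..1}. g z \<le> 0}"
  have KI: "compact (K \<times> {0..1::real})" using K by (intro compact_Times) auto
  have "closed S"
    unfolding S_def using compact_imp_closed[OF KI] cont continuous_on_const
    by (rule continuous_on_closed_Collect_le[rotated 2])
  then have "compact S"
    using compact_Int_closed[OF KI, of S] by (simp add: S_def Int_def conj_ac cong: conj_cong)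
  then have "compact (snd ` S)"
    by (intro compact_continuous_image continuous_intros)
  then have "open (- snd ` S)" by (simp add: compact_imp_closed open_Compl)
  moreover have "0 \<notin> snd ` S" using pos by (force simp: S_def)
  ultimately have "\<forall>\<^sub>F e in nhds 0. e \<in> - snd ` S" by (intro eventually_nhds_in_open) auto
  then have "\<forall>\<^sub>F e in at_right 0. e \<notin> snd ` S"
    by (auto simp: at_within_def eventually_inf_principal elim: eventually_mono)
  moreover have "\<forall>\<^sub>F e in at_right 0. e \<in> {0<..<1::real}"
    by (rule eventually_at_right_real) simp
  ultimately show ?thesis
  proof eventually_elim
    case (elim e)
    show ?case
    proof (rule ballI, rule ccontr)
      fix x assume "x \<in> K" "\<not> 0 < g (x, e)"
      then have "(x, e) \<in> S" using elim(2) by (simp add: S_def)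
      then show False using elim(1) by force
    qed
  qed
qed

section \<open>Kernel vectors of the Hermitian pencil and Williamson's normal form\<close>

lemma Omega_carrier [simp]: "Omega p \<in> carrier_mat (2 * p) (2 * p)" "dim_row (Omega p) = 2 * p" "dim_col (Omega p) = 2 * p"
  by (auto simp: Omega_def)

lemma Omega_mult_carrier [simp]: "x \<in> carrier_vec (2 * p) \<Longrightarrow> Omega p *\<^sub>v x \<in> carrier_vec (2 * p)"
  by (rule mult_mat_vec_carrier[OF Omega_carrier(1)])

lemma Omega_index:
  assumes "i < 2 * p" "j < 2 * p"
  shows "Omega p $$ (i, j) = (if j = i + p then 1 else if i = j + p then -1 else 0)"
  using assms by (auto simp: Omega_def)

lemma transpose_Omega: "transpose_mat (Omega p) = - Omega p"
  by (intro eq_matI) (auto simp: Omega_index)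

lemma Omega_skew:
  assumes "x \<in> carrier_vec (2 * p)" "y \<in> carrier_vec (2 * p)"
  shows "x \<bullet> (Omega p *\<^sub>v y) = - (y \<bullet> (Omega p *\<^sub>v x))"
proof -
  have "x \<bullet> (Omega p *\<^sub>v y) = (transpose_mat (Omega p) *\<^sub>v x) \<bullet> y"
    using transpose_vec_mult_scalar[of "Omega p" "2*p" "2*p" y x] assms by simp
  also have "\<dots> = - ((Omega p *\<^sub>v x) \<bullet> y)"
    using assms by (simp add: transpose_Omega)
  also have "(Omega p *\<^sub>v x) \<bullet> y = y \<bullet> (Omega p *\<^sub>v x)"
    using assms by (intro comm_scalar_prod[of _ "2*p"]) auto
  finally show ?thesis .
qed

lemma symmetric_form:
  fixes N :: "real mat"
  assumes "N \<in> carrier_mat n n" "transpose_mat N = N" "x \<in> carrier_vec n" "y \<in> carrier_vec n"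
  shows "x \<bullet> (N *\<^sub>v y) = y \<bullet> (N *\<^sub>v x)"
proof -
  have "x \<bullet> (N *\<^sub>v y) = (N *\<^sub>v x) \<bullet> y"
    using transpose_vec_mult_scalar[of N n n y x] assms by simp
  then show ?thesis
    using assms by (simp add: comm_scalar_prod[of "N *\<^sub>v x" n])
qed

text \<open>Entries of a congruence transform are values of the bilinear form on the columns. Hence a matrix
  is symplectic, or diagonalizes \<open>N\<close>, exactly if its columns have prescribed products under
  \<open>Omega p\<close> or \<open>N\<close>.\<close>

lemma congruence_entry:
  fixes S A :: "real mat"
  assumes "S \<in> carrier_mat n n" "A \<in> carrier_mat n n" "i < n" "j < n"
  shows "(transpose_mat S * A * S) $$ (i, j) = col S i \<bullet> (A *\<^sub>v col S j)"
proof -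
  have "transpose_mat S * A * S = transpose_mat S * (A * S)"
    using assms by (intro assoc_mult_mat) auto
  then show ?thesis
    using assms col_mult2[OF assms(2,1), of j] by simp
qed

text \<open>The Hermitian matrix \<open>N + \<i> l Omega\<close>. For \<open>N\<close> positive definite, it is singular exactly if
  \<open>l\<close> or \<open>- l\<close> is a symplectic eigenvalue of \<open>N\<close>.\<close>

definition pencil :: "nat \<Rightarrow> real mat \<Rightarrow> real \<Rightarrow> complex mat" where
  "pencil p N l = mat (2 * p) (2 * p) (\<lambda>(i, j). Complex (N $$ (i, j)) (l * Omega p $$ (i, j)))"

lemma pencil_carrier [simp]: "pencil p N l \<in> carrier_mat (2 * p) (2 * p)"
  by (simp add: pencil_def)

text \<open>The real and imaginary part of the equation \<open>(N + \<i> l Omega) (a + \<i> b) = 0\<close>. A symplectic basis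
  that brings \<open>N\<close> into Williamson's normal form consists of such pairs.\<close>

definition symplectic_eigenpair :: "nat \<Rightarrow> real mat \<Rightarrow> real \<Rightarrow> real vec \<Rightarrow> real vec \<Rightarrow> bool" where
  "symplectic_eigenpair p N l a b \<longleftrightarrow> a \<in> carrier_vec (2 * p) \<and> b \<in> carrier_vec (2 * p) \<and>
     N *\<^sub>v a = l \<cdot>\<^sub>v (Omega p *\<^sub>v b) \<and> N *\<^sub>v b = - l \<cdot>\<^sub>v (Omega p *\<^sub>v a)"

lemma pencil_kernel:
  assumes N: "N \<in> carrier_mat (2 * p) (2 * p)" and ab: "a \<in> carrier_vec (2 * p)" "b \<in> carrier_vec (2 * p)"
  shows "symplectic_eigenpair p N l a b \<longleftrightarrow>
     (\<forall>i<2*p. (\<Sum>j<2*p. pencil p N l $$ (i, j) * Complex (a $ j) (b $ j)) = 0)"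
proof -
  have entry: "(\<Sum>j<2*p. pencil p N l $$ (i, j) * Complex (a $ j) (b $ j)) =
      Complex ((N *\<^sub>v a) $ i - l * (Omega p *\<^sub>v b) $ i) ((N *\<^sub>v b) $ i + l * (Omega p *\<^sub>v a) $ i)"
    if "i < 2 * p" for i
    using that N ab
    by (auto simp: complex_eq_iff pencil_def scalar_prod_def sum_distrib_left sum_subtractf sum.distrib
        lessThan_atLeast0 algebra_simps)
  have "symplectic_eigenpair p N l a b \<longleftrightarrow>
     (\<forall>i<2*p. (N *\<^sub>v a) $ i - l * (Omega p *\<^sub>v b) $ i = 0 \<and> (N *\<^sub>v b) $ i + l * (Omega p *\<^sub>v a) $ i = 0)"
  proof -
    have eq: "v = w \<longleftrightarrow> (\<forall>i<2*p. v $ i = w $ i)" if "v \<in> carrier_vec (2 * p)" "w \<in> carrier_vec (2 * p)"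
      for v w :: "real vec"
      using that by (auto simp: vec_eq_iff)
    have "N *\<^sub>v a = l \<cdot>\<^sub>v (Omega p *\<^sub>v b) \<longleftrightarrow> (\<forall>i<2*p. (N *\<^sub>v a) $ i - l * (Omega p *\<^sub>v b) $ i = 0)"
      using N ab by (subst eq) (auto simp del: index_mult_mat_vec)
    moreover have "N *\<^sub>v b = - l \<cdot>\<^sub>v (Omega p *\<^sub>v a) \<longleftrightarrow> (\<forall>i<2*p. (N *\<^sub>v b) $ i + l * (Omega p *\<^sub>v a) $ i = 0)"
      using N ab by (subst eq) (auto simp: eq_neg_iff_add_eq_0 simp del: index_mult_mat_vec)
    ultimately show ?thesis
      using ab unfolding symplectic_eigenpair_def by blast
  qed
  then show ?thesis
    by (simp add: entry complex_eq_iff)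
qed

lemma det_pencil_zero_imp_eigenpair:
  assumes N: "N \<in> carrier_mat (2 * p) (2 * p)" and "det (pencil p N l) = 0"
  shows "\<exists>a b. symplectic_eigenpair p N l a b \<and> (a \<noteq> 0\<^sub>v (2 * p) \<or> b \<noteq> 0\<^sub>v (2 * p))"
proof -
  obtain v where v: "v \<in> carrier_vec (2 * p)" "v \<noteq> 0\<^sub>v (2 * p)" "pencil p N l *\<^sub>v v = 0\<^sub>v (2 * p)"
    using assms(2) det_0_iff_vec_prod_zero[OF pencil_carrier, of p N l] by blast
  define a b where "a = map_vec Re v" and "b = map_vec Im v"
  have ab: "a \<in> carrier_vec (2 * p)" "b \<in> carrier_vec (2 * p)"
    using v(1) by (auto simp: a_def b_def)
  have vab: "Complex (a $ j) (b $ j) = v $ j" if "j < 2 * p" for j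
    using v(1) that by (simp add: a_def b_def)
  have "(\<Sum>j<2*p. pencil p N l $$ (i, j) * Complex (a $ j) (b $ j)) = 0" if "i < 2 * p" for i
  proof -
    have "(\<Sum>j<2*p. pencil p N l $$ (i, j) * Complex (a $ j) (b $ j)) = (pencil p N l *\<^sub>v v) $ i"
      using that v(1) by (simp add: vab scalar_prod_def lessThan_atLeast0 pencil_def)
    then show ?thesis using v(3) that by simp
  qed
  then have "symplectic_eigenpair p N l a b"
    using pencil_kernel[OF N ab] by blast
  moreover have "a \<noteq> 0\<^sub>v (2 * p) \<or> b \<noteq> 0\<^sub>v (2 * p)"
  proof (rule ccontr)
    assume "\<not> ?thesis"
    then have "v $ j = 0" if "j < 2 * p" for j
      using vab[OF that] that by (auto simp: complex_eq_iff)
    then show False using v(1,2) by auto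
  qed
  ultimately show ?thesis by blast
qed

lemma eigenpair_scale:
  assumes "symplectic_eigenpair p N l a b" "N \<in> carrier_mat (2 * p) (2 * p)"
  shows "symplectic_eigenpair p N l (c \<cdot>\<^sub>v a) (c \<cdot>\<^sub>v b)"
  using assms unfolding symplectic_eigenpair_def
  by (auto simp: mult_mat_vec[of _ "2*p" "2*p"] smult_smult_assoc mult.commute)

lemma eigenpair_forms:
  assumes N: "N \<in> carrier_mat (2 * p) (2 * p)" "transpose_mat N = N"
    and ab: "symplectic_eigenpair p N l a b" and x: "x \<in> carrier_vec (2 * p)"
  shows "x \<bullet> (N *\<^sub>v a) = l * (x \<bullet> (Omega p *\<^sub>v b))"
    and "x \<bullet> (N *\<^sub>v b) = - l * (x \<bullet> (Omega p *\<^sub>v a))"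
  using assms unfolding symplectic_eigenpair_def by (auto)

text \<open>Both \<open>a \<bullet> N a\<close> and \<open>b \<bullet> N b\<close> equal \<open>l\<close> times the symplectic product of \<open>a\<close> and \<open>b\<close>. So this product
  is positive, and a common scaling of \<open>a\<close> and \<open>b\<close> makes it \<open>1\<close>.\<close>

lemma eigenpair_normalized:
  assumes N: "positive_definite (2 * p) N" and l: "l > 0"
    and ab: "symplectic_eigenpair p N l a b" and nz: "a \<noteq> 0\<^sub>v (2 * p) \<or> b \<noteq> 0\<^sub>v (2 * p)"
  shows "\<exists>a b. symplectic_eigenpair p N l a b \<and> a \<bullet> (Omega p *\<^sub>v b) = 1"
proof -
  have NC: "N \<in> carrier_mat (2 * p) (2 * p)" "transpose_mat N = N"
    using N by (auto simp: positive_definite_def)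
  have c: "a \<in> carrier_vec (2 * p)" "b \<in> carrier_vec (2 * p)"
    using ab by (auto simp: symplectic_eigenpair_def)
  define w where "w = a \<bullet> (Omega p *\<^sub>v b)"
  have aa: "a \<bullet> (N *\<^sub>v a) = l * w" and bb: "b \<bullet> (N *\<^sub>v b) = l * w"
    using eigenpair_forms[OF NC ab] c Omega_skew[OF c] by (auto simp: w_def)
  have "l * w > 0"
    using nz N c aa bb unfolding positive_definite_def by metis
  then have w: "w > 0" using l by (simp add: zero_less_mult_iff)
  define r where "r = 1 / sqrt w"
  have "(r \<cdot>\<^sub>v a) \<bullet> (Omega p *\<^sub>v (r \<cdot>\<^sub>v b)) = r * r * w"
    using c by (simp add: mult_mat_vec[of _ "2*p" "2*p"] w_def)
  also have "\<dots> = 1" using w by (simp add: r_def)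
  finally show ?thesis using eigenpair_scale[OF ab NC(1), of r] by blast
qed

text \<open>Evaluating the symmetric form \<open>N\<close> on one vector from each pair in both orders gives relations
  \<open>k u = l v\<close> and \<open>k v = l u\<close> between symplectic products \<open>u\<close> and \<open>v\<close>. They force
  \<open>k\<^sup>2 u = l\<^sup>2 u\<close>, hence \<open>u = v = 0\<close>.\<close>

lemma eigenpair_orthogonal:
  assumes N: "N \<in> carrier_mat (2 * p) (2 * p)" "transpose_mat N = N"
    and 1: "symplectic_eigenpair p N l a b" and 2: "symplectic_eigenpair p N k c d"
    and lk: "l > 0" "k > 0" "l \<noteq> k"
  shows "a \<bullet> (Omega p *\<^sub>v d) = 0" "a \<bullet> (Omega p *\<^sub>v c) = 0" "b \<bullet> (Omega p *\<^sub>v d) = 0" "b \<bullet> (Omega p *\<^sub>v c) = 0"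
proof -
  have cv: "a \<in> carrier_vec (2 * p)" "b \<in> carrier_vec (2 * p)" "c \<in> carrier_vec (2 * p)" "d \<in> carrier_vec (2 * p)"
    using 1 2 by (auto simp: symplectic_eigenpair_def)
  note sk = Omega_skew[of c p a] Omega_skew[of c p b] Omega_skew[of d p a] Omega_skew[of d p b]
  have crossed: "u = 0 \<and> v = 0" if "k * u = l * v" "k * v = l * u" for u v :: real
  proof -
    have "k * (k * u) = l * (l * u)" using that by (metis mult.left_commute)
    then have "(k * k - l * l) * u = 0" by (simp add: algebra_simps)
    moreover have "k * k - l * l \<noteq> 0"
      using lk by (metis eq_iff_diff_eq_0 less_eq_real_def mult_less_cancel_left_pos mult_strict_mono not_less_iff_gr_or_eq)
    ultimately have "u = 0" by simp
    then show ?thesis using that lk by simp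
  qed
  have h1: "k * (a \<bullet> (Omega p *\<^sub>v d)) = l * - (b \<bullet> (Omega p *\<^sub>v c))"
    using symmetric_form[OF N cv(1,3)] eigenpair_forms(1)[OF N 2 cv(1)] eigenpair_forms(1)[OF N 1 cv(3)] sk cv by simp
  have h2: "k * - (b \<bullet> (Omega p *\<^sub>v c)) = l * (a \<bullet> (Omega p *\<^sub>v d))"
    using symmetric_form[OF N cv(2,4)] eigenpair_forms(2)[OF N 2 cv(2)] eigenpair_forms(2)[OF N 1 cv(4)] sk cv by simp
  show "a \<bullet> (Omega p *\<^sub>v d) = 0" "b \<bullet> (Omega p *\<^sub>v c) = 0"
    using crossed[OF h1 h2] by simp_all
  have h3: "k * (a \<bullet> (Omega p *\<^sub>v c)) = l * (b \<bullet> (Omega p *\<^sub>v d))"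
    using symmetric_form[OF N cv(1,4)] eigenpair_forms(2)[OF N 2 cv(1)] eigenpair_forms(1)[OF N 1 cv(4)] sk cv by simp
  have h4: "k * (b \<bullet> (Omega p *\<^sub>v d)) = l * (a \<bullet> (Omega p *\<^sub>v c))"
    using symmetric_form[OF N cv(2,3)] eigenpair_forms(1)[OF N 2 cv(2)] eigenpair_forms(2)[OF N 1 cv(3)] sk cv by simp
  show "a \<bullet> (Omega p *\<^sub>v c) = 0" "b \<bullet> (Omega p *\<^sub>v d) = 0"
    using crossed[OF h3 h4] by simp_all
qed

text \<open>Williamson's theorem in the case of simple eigenvalues, where no choice within eigenspaces is
  involved: normalized eigenpairs for distinct values are symplectically orthogonal, so
  \<open>a 0, \<dots>, a (p - 1), b 0, \<dots>, b (p - 1)\<close> are the columns of the required symplectic matrix.\<close>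

lemma Williamson_distinct:
  assumes N: "positive_definite (2 * p) N"
    and l: "inj_on l {..<p}" "\<And>j. j < p \<Longrightarrow> l j > 0" "\<And>j. j < p \<Longrightarrow> det (pencil p N (l j)) = 0"
  shows "has_symplectic_spectrum p N (mset (map l [0..<p]))"
proof -
  have NC: "N \<in> carrier_mat (2 * p) (2 * p)" "transpose_mat N = N"
    using N by (auto simp: positive_definite_def)
  have "\<forall>j\<in>{..<p}. \<exists>a b. symplectic_eigenpair p N (l j) a b \<and> a \<bullet> (Omega p *\<^sub>v b) = 1"
    using det_pencil_zero_imp_eigenpair[OF NC(1) l(3)] eigenpair_normalized[OF N l(2)] by (metis lessThan_iff)
  then obtain a b where ab: "\<And>j. j < p \<Longrightarrow> symplectic_eigenpair p N (l j) (a j) (b j)"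
    and norm: "\<And>j. j < p \<Longrightarrow> a j \<bullet> (Omega p *\<^sub>v b j) = 1"
    by (metis lessThan_iff)
  have cv: "a j \<in> carrier_vec (2 * p)" "b j \<in> carrier_vec (2 * p)" if "j < p" for j
    using ab[OF that] by (auto simp: symplectic_eigenpair_def)
  have self: "a j \<bullet> (Omega p *\<^sub>v a j) = 0" "b j \<bullet> (Omega p *\<^sub>v b j) = 0" if "j < p" for j
    using Omega_skew[of "a j" p "a j"] Omega_skew[of "b j" p "b j"] cv[OF that] by auto
  have ne: "l i \<noteq> l j" if "i < p" "j < p" "i \<noteq> j" for i j
    using l(1) that by (auto simp: inj_on_def)
  have om: "a i \<bullet> (Omega p *\<^sub>v b j) = (if i = j then 1 else 0)"
    "b i \<bullet> (Omega p *\<^sub>v a j) = (if i = j then -1 else 0)"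
    "a i \<bullet> (Omega p *\<^sub>v a j) = 0" "b i \<bullet> (Omega p *\<^sub>v b j) = 0" if "i < p" "j < p" for i j
  proof -
    have "b i \<bullet> (Omega p *\<^sub>v a i) = -1"
      using Omega_skew[OF cv(2,1), OF that(1) that(1)] norm[OF that(1)] by simp
    then show "a i \<bullet> (Omega p *\<^sub>v b j) = (if i = j then 1 else 0)"
      "b i \<bullet> (Omega p *\<^sub>v a j) = (if i = j then -1 else 0)"
      "a i \<bullet> (Omega p *\<^sub>v a j) = 0" "b i \<bullet> (Omega p *\<^sub>v b j) = 0"
      using eigenpair_orthogonal[OF NC ab[OF that(1)] ab[OF that(2)] l(2)[OF that(1)] l(2)[OF that(2)]]
        ne[OF that] self[OF that(1)] norm[OF that(1)] by (cases "i = j"; simp)+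
  qed
  define S where "S = mat_of_cols (2 * p) (map (\<lambda>j. if j < p then a j else b (j - p)) [0..<2 * p])"
  have S: "S \<in> carrier_mat (2 * p) (2 * p)"
    using mat_of_cols_carrier(1)[of "2*p" "map (\<lambda>j. if j < p then a j else b (j - p)) [0..<2 * p]"]
    by (simp add: S_def)
  have colS: "col S j = (if j < p then a j else b (j - p))" if "j < 2 * p" for j
    unfolding S_def using that cv by (subst col_mat_of_cols) auto
  have "transpose_mat S * Omega p * S = Omega p"
  proof (rule eq_matI)
    fix i j assume "i < dim_row (Omega p)" "j < dim_col (Omega p)"
    then have ij: "i < 2 * p" "j < 2 * p" by auto
    show "(transpose_mat S * Omega p * S) $$ (i, j) = Omega p $$ (i, j)"
      using ij by (auto simp: congruence_entry[OF S] colS om Omega_index)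
  qed (use S in auto)
  then have "symplectic p S" using S by (simp add: symplectic_def)
  define D where "D = mat p p (\<lambda>(i, j). if i = j then l i else 0)"
  have "transpose_mat S * N * S = four_block_mat D (0\<^sub>m p p) (0\<^sub>m p p) D"
  proof (rule eq_matI)
    fix i j assume "i < dim_row (four_block_mat D (0\<^sub>m p p) (0\<^sub>m p p) D)" "j < dim_col (four_block_mat D (0\<^sub>m p p) (0\<^sub>m p p) D)"
    then have ij: "i < 2 * p" "j < 2 * p" by (auto simp: D_def)
    have form: "x \<bullet> (N *\<^sub>v a k) = l k * (x \<bullet> (Omega p *\<^sub>v b k))"
      "x \<bullet> (N *\<^sub>v b k) = - l k * (x \<bullet> (Omega p *\<^sub>v a k))" if "x \<in> carrier_vec (2 * p)" "k < p" for x k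
      using eigenpair_forms[OF NC ab] that by auto
    show "(transpose_mat S * N * S) $$ (i, j) = four_block_mat D (0\<^sub>m p p) (0\<^sub>m p p) D $$ (i, j)"
      using ij cv by (auto simp: congruence_entry[OF S NC(1)] colS form om D_def)
  qed (use S in \<open>auto simp: D_def\<close>)
  moreover have "diag_mat D = map l [0..<p]"
    by (simp add: diag_mat_def D_def)
  moreover have "D \<in> carrier_mat p p" "diagonal_mat D" "\<forall>i<p. D $$ (i, i) > 0"
    using l(2) by (auto simp: D_def diagonal_mat_def)
  ultimately show ?thesis
    using \<open>symplectic p S\<close> unfolding has_symplectic_spectrum_def by metis
qed

section \<open>Positive definite matrices with a given graph and distinct symplectic eigenvalues\<close>

text \<open>A matrix with the pattern of a graph whose edges all carry the weight \<open>e\<close>. Its diagonal repeats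
  \<open>d\<close> on both members of every pair, so that at \<open>e = 0\<close> it is already in Williamson's normal form.\<close>

definition graph_matrix :: "nat \<Rightarrow> (nat \<Rightarrow> nat \<Rightarrow> bool) \<Rightarrow> (nat \<Rightarrow> real) \<Rightarrow> real \<Rightarrow> real mat" where
  "graph_matrix p E d e = mat (2 * p) (2 * p) (\<lambda>(i, j). if i = j then d (i mod p) else if E i j then e else 0)"

lemma graph_matrix_carrier [simp]: "graph_matrix p E d e \<in> carrier_mat (2 * p) (2 * p)"
  by (simp add: graph_matrix_def)

lemma graph_matrix_transpose:
  assumes "\<And>i j. E i j \<longleftrightarrow> E j i"
  shows "transpose_mat (graph_matrix p E d e) = graph_matrix p E d e"
  using assms by (intro eq_matI) (auto simp: graph_matrix_def)

text \<open>Diagonal dominance, in the form \<open>\<bar>x\<^sub>i x\<^sub>j\<bar> \<le> (x\<^sub>i\<^sup>2 + x\<^sub>j\<^sup>2) / 2\<close>.\<close>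

lemma positive_definite_graph_matrix:
  assumes E: "\<And>i j. E i j \<longleftrightarrow> E j i" and d: "\<And>k. k < p \<Longrightarrow> c \<le> d k" and e: "0 \<le> e" "2 * real p * e < c"
  shows "positive_definite (2 * p) (graph_matrix p E d e)"
  unfolding positive_definite_def
proof (intro conjI ballI impI)
  let ?N = "graph_matrix p E d e"
  fix x :: "real vec" assume x: "x \<in> carrier_vec (2 * p)" "x \<noteq> 0\<^sub>v (2 * p)"
  define n where "n = (\<Sum>i<2*p. (x $ i)\<^sup>2)"
  have "\<exists>i<2*p. x $ i \<noteq> 0"
  proof (rule ccontr)
    assume "\<not> ?thesis"
    then have "x = 0\<^sub>v (2 * p)" using x(1) by (intro eq_vecI) auto
    then show False using x(2) by simp
  qed
  then obtain i where "i < 2 * p" "x $ i \<noteq> 0" by blast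
  then have n: "n > 0"
    unfolding n_def by (intro sum_pos2[of _ i]) auto
  have entry: "(if i = j then c * (x $ i)\<^sup>2 else 0) - e * (((x $ i)\<^sup>2 + (x $ j)\<^sup>2) / 2) \<le> x $ i * (?N $$ (i, j) * x $ j)"
    if "i < 2 * p" "j < 2 * p" for i j
  proof (cases "i = j")
    case True
    have "p > 0" using that by auto
    then have "c * (x $ i)\<^sup>2 \<le> d (i mod p) * (x $ i)\<^sup>2"
      by (intro mult_right_mono d) auto
    moreover have "0 \<le> e * (x $ i)\<^sup>2" using e by simp
    ultimately show ?thesis
      using True that by (simp add: graph_matrix_def power2_eq_square algebra_simps)
  next
    case False
    have "0 \<le> (x $ i + x $ j)\<^sup>2" by simp
    then have "- (((x $ i)\<^sup>2 + (x $ j)\<^sup>2) / 2) \<le> x $ i * x $ j"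
      by (simp add: power2_sum field_simps)
    then have "e * - (((x $ i)\<^sup>2 + (x $ j)\<^sup>2) / 2) \<le> e * (x $ i * x $ j)"
      using e(1) by (rule mult_left_mono)
    moreover have "0 \<le> e * (((x $ i)\<^sup>2 + (x $ j)\<^sup>2) / 2)" using e by simp
    ultimately show ?thesis
      using False that by (auto simp: graph_matrix_def algebra_simps)
  qed
  have "(c - 2 * real p * e) * n = (\<Sum>i<2*p. \<Sum>j<2*p. (if i = j then c * (x $ i)\<^sup>2 else 0) - e * (((x $ i)\<^sup>2 + (x $ j)\<^sup>2) / 2))"
    by (simp add: sum_subtractf sum.distrib n_def algebra_simps add_divide_distrib
        flip: sum_distrib_left sum_divide_distrib)
  also have "\<dots> \<le> (\<Sum>i<2*p. \<Sum>j<2*p. x $ i * (?N $$ (i, j) * x $ j))"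
    using entry by (intro sum_mono) auto
  also have "\<dots> = x \<bullet> (?N *\<^sub>v x)"
    using x(1) by (simp add: scalar_prod_def lessThan_atLeast0 sum_distrib_left graph_matrix_def)
  finally have "(c - 2 * real p * e) * n \<le> x \<bullet> (?N *\<^sub>v x)" .
  moreover have "0 < (c - 2 * real p * e) * n" using n e by simp
  ultimately show "x \<bullet> (?N *\<^sub>v x) > 0" by linarith
qed (use graph_matrix_transpose[OF E] in auto)

lemma det_diagonal_matrix:
  "det (mat n n (\<lambda>(i, j). if i = j then f i else 0)) = (\<Prod>i<n. f i)" for f :: "nat \<Rightarrow> complex"
proof -
  have "det (mat n n (\<lambda>(i, j). if i = j then f i else 0)) = prod_list (map f [0..<n])"
    by (subst det_lower_triangular[of n]) (auto simp: diag_mat_def intro!: arg_cong[of _ _ prod_list])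
  also have "\<dots> = (\<Prod>i<n. f i)"
    by (simp add: prod.distinct_set_conv_list[symmetric] lessThan_atLeast0)
  finally show ?thesis .
qed

text \<open>At \<open>e = 0\<close> the pencil consists of four diagonal blocks, which commute.\<close>

lemma det_pencil_diagonal:
  "det (pencil p (graph_matrix p E d 0) l) = of_real (\<Prod>k<p. (d k)\<^sup>2 - l\<^sup>2)"
proof -
  define diag :: "(nat \<Rightarrow> complex) \<Rightarrow> complex mat" where
    "diag f = mat p p (\<lambda>(i, j). if i = j then f i else 0)" for f
  have diag_carrier [simp]: "diag f \<in> carrier_mat p p" for f by (simp add: diag_def)
  have diag_mult: "diag f * diag g = diag (\<lambda>i. f i * g i)" for f g
  proof (rule eq_matI)
    fix i j assume "i < dim_row (diag (\<lambda>i. f i * g i))" "j < dim_col (diag (\<lambda>i. f i * g i))"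
    then have ij: "i < p" "j < p" by (auto simp: diag_def)
    have "(diag f * diag g) $$ (i, j) = (\<Sum>k<p. (if i = k then f i else 0) * (if k = j then g k else 0))"
      using ij by (simp add: diag_def scalar_prod_def lessThan_atLeast0)
    also have "\<dots> = (\<Sum>k<p. if k = i then (if i = j then f i * g i else 0) else 0)"
      by (intro sum.cong) auto
    finally show "(diag f * diag g) $$ (i, j) = diag (\<lambda>i. f i * g i) $$ (i, j)"
      using ij by (simp add: diag_def)
  qed (auto simp: diag_def)
  have "pencil p (graph_matrix p E d 0) l =
      four_block_mat (diag (\<lambda>i. of_real (d i))) (diag (\<lambda>_. Complex 0 l)) (diag (\<lambda>_. Complex 0 (- l))) (diag (\<lambda>i. of_real (d i)))"
    by (rule eq_matI)
       (auto simp: pencil_def graph_matrix_def diag_def Omega_index complex_eq_iff mod_if)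
  then have "det (pencil p (graph_matrix p E d 0) l) =
     det (diag (\<lambda>i. of_real (d i)) * diag (\<lambda>i. of_real (d i)) - diag (\<lambda>_. Complex 0 l) * diag (\<lambda>_. Complex 0 (- l)))"
    by (simp add: det_four_block_mat[of _ p] diag_mult mult.commute)
  also have "diag (\<lambda>i. of_real (d i)) * diag (\<lambda>i. of_real (d i)) - diag (\<lambda>_. Complex 0 l) * diag (\<lambda>_. Complex 0 (- l))
     = diag (\<lambda>i. of_real ((d i)\<^sup>2 - l\<^sup>2))"
    unfolding diag_mult by (rule eq_matI) (auto simp: diag_def complex_eq_iff power2_eq_square)
  also have "det \<dots> = of_real (\<Prod>k<p. (d k)\<^sup>2 - l\<^sup>2)"
    unfolding diag_def by (simp only: det_diagonal_matrix of_real_prod)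
  finally show ?thesis .
qed

text \<open>The pencil is Hermitian. This makes the singularity of the pencil a single real equation, to
  which the intermediate value argument can be applied.\<close>

lemma det_pencil_real:
  assumes N: "N \<in> carrier_mat (2 * p) (2 * p)" "transpose_mat N = N"
  shows "det (pencil p N l) = of_real (Re (det (pencil p N l)))"
proof -
  interpret cnj: comm_ring_hom cnj by unfold_locales auto
  have sym: "N $$ (i, j) = N $$ (j, i)" if "i < 2 * p" "j < 2 * p" for i j
    using N that by (metis carrier_matD index_transpose_mat(1))
  have "map_mat cnj (pencil p N l) = transpose_mat (pencil p N l)"
    using sym by (intro eq_matI) (auto simp: pencil_def Omega_index complex_eq_iff)
  then have "cnj (det (pencil p N l)) = det (pencil p N l)"
    using cnj.hom_det[of "pencil p N l"] det_transpose[OF pencil_carrier] by metis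
  then show ?thesis
    by (simp add: complex_eq_iff)
qed

lemma continuous_on_det_pencil:
  fixes l :: real
  shows "continuous_on A (\<lambda>z. Re (det (pencil p (graph_matrix p E (fst z) (snd z)) l)))"
proof -
  have coord: "continuous_on A (\<lambda>z. fst z k)" for k and A :: "((nat \<Rightarrow> real) \<times> real) set"
    by (rule continuous_on_product_then_coordinatewise) (intro continuous_intros)
  have "continuous_on A (\<lambda>z. pencil p (graph_matrix p E (fst z) (snd z)) l $$ (i, j))"
    if "i < 2 * p" "j < 2 * p" for i j
    using that coord
    by (cases "i = j"; cases "E i j") (auto simp: pencil_def graph_matrix_def Complex_eq intro!: continuous_intros)
  then have entry: "continuous_on A (\<lambda>z. pencil p (graph_matrix p E (fst z) (snd z)) l $$ (i, \<pi> i))"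
    if "\<pi> permutes {0..<2 * p}" "i \<in> {0..<2 * p}" for \<pi> i
    using that permutes_in_image[OF that(1), of i] by auto
  show ?thesis
    unfolding det_def'[OF pencil_carrier] by (intro continuous_intros entry) auto
qed

text \<open>The equations \<open>det (N + \<i> l\<^sub>j Omega) = 0\<close>, one for each prescribed value \<open>l\<^sub>j\<close>, are solved for the
  diagonal \<open>d\<close>. For \<open>e = 0\<close> the left-hand side is the product of all \<open>d\<^sub>k\<^sup>2 - l\<^sub>j\<^sup>2\<close>; on a small box around
  \<open>(l\<^sub>1, \<dots>, l\<^sub>p)\<close> only the factor with \<open>k = j\<close> changes sign, and it does so between the two opposite
  faces in direction \<open>j\<close>. By compactness the signs on the faces persist for small \<open>e > 0\<close>, and then the
  Poincare-Miranda theorem provides a solution with the edges present.\<close>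

lemma distinct_symplectic_spectrum_realizable:
  assumes E: "\<And>i j. E i j \<longleftrightarrow> E j i"
    and l: "inj_on l {..<p}" "\<And>j. j < p \<Longrightarrow> l j > 0"
  shows "\<exists>N. positive_definite (2 * p) N \<and>
     (\<forall>i<2*p. \<forall>j<2*p. i \<noteq> j \<longrightarrow> (N $$ (i, j) \<noteq> 0 \<longleftrightarrow> E i j)) \<and>
     has_symplectic_spectrum p N (mset (map l [0..<p]))"
proof -
  have small: "\<forall>\<^sub>F t in at_right 0. a * t < b" if "b > 0" for a b :: real
  proof -
    have "((\<lambda>t. a * t) \<longlongrightarrow> a * 0) (at_right 0)"
      by (intro tendsto_mult tendsto_const tendsto_ident_at)
    then show ?thesis using that by (intro order_tendstoD(2)) auto
  qed
  \<comment> \<open>The radius \<open>t\<close> of the box is small enough that \<open>d\<^sub>k - l\<^sub>j\<close> keeps the sign of \<open>l\<^sub>k - l\<^sub>j\<close> for \<open>k \<noteq> j\<close> and that all \<open>d\<^sub>k\<close> exceed \<open>t\<close>.\<close>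
  have "\<forall>\<^sub>F t in at_right 0. 0 < t \<and> (\<forall>k\<in>{..<p}. 2 * t < l k) \<and>
      (\<forall>k\<in>{..<p}. \<forall>j\<in>{..<p} - {k}. t < \<bar>l k - l j\<bar>)"
    using l by (intro eventually_conj eventually_ball_finite ballI)
      (auto intro!: small small[of _ 1, simplified] eventually_at_right_less simp: inj_on_def)
  then obtain t where t: "0 < t" "\<And>k. k < p \<Longrightarrow> 2 * t < l k"
    "\<And>k j. k < p \<Longrightarrow> j < p \<Longrightarrow> k \<noteq> j \<Longrightarrow> t < \<bar>l k - l j\<bar>"
    by (auto dest!: eventually_happens)
  define K where "K = {x. \<forall>i. x i \<in> {l i - t..l i + t}}"
  have K: "compact K" unfolding K_def by (rule compact_box_fun)
  define w where "w j = (\<Prod>k\<in>{..<p}-{j}. (l k)\<^sup>2 - (l j)\<^sup>2)" for j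
  \<comment> \<open>The constant factor \<open>w j\<close> normalizes the sign: \<open>F j\<close> increases in direction \<open>j\<close> at \<open>e = 0\<close>.\<close>
  define F where "F j z = w j * Re (det (pencil p (graph_matrix p E (fst z) (snd z)) (l j)))" for j z
  have contF: "continuous_on A (F j)" for A j
    unfolding F_def by (intro continuous_intros continuous_on_det_pencil)
  have w0: "w j \<noteq> 0" if "j < p" for j
  proof -
    have "(l k)\<^sup>2 \<noteq> (l j)\<^sup>2" if "k < p" "k \<noteq> j" for k
      using l(1) l(2)[OF \<open>j < p\<close>] l(2)[OF \<open>k < p\<close>] that \<open>j < p\<close> by (auto simp: inj_on_def power2_eq_iff)
    then show ?thesis by (auto simp: w_def)
  qed
  have F0: "\<exists>c>0. F j (x, 0) = c * ((x j)\<^sup>2 - (l j)\<^sup>2)" if j: "j < p" and x: "x \<in> K" for j x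
  proof (intro exI conjI)
    let ?c = "\<Prod>k\<in>{..<p}-{j}. ((l k)\<^sup>2 - (l j)\<^sup>2) * ((x k)\<^sup>2 - (l j)\<^sup>2)"
    show "?c > 0"
    proof (rule prod_pos)
      fix k assume "k \<in> {..<p} - {j}"
      then have k: "k < p" "k \<noteq> j" by auto
      have xk: "\<bar>x k - l k\<bar> \<le> t" using x unfolding K_def by (auto simp: abs_le_iff dest!: spec[of _ k])
      have "0 < (l k - l j) * (x k - l j)"
        using t(3)[OF k(1) j k(2)] xk by (auto simp: zero_less_mult_iff)
      moreover have "0 < (l k + l j) * (x k + l j)"
        using t(2)[OF k(1)] t(1) l(2)[OF j] xk by (intro mult_pos_pos) auto
      ultimately have "0 < ((l k - l j) * (x k - l j)) * ((l k + l j) * (x k + l j))"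
        by (rule mult_pos_pos)
      then show "0 < ((l k)\<^sup>2 - (l j)\<^sup>2) * ((x k)\<^sup>2 - (l j)\<^sup>2)"
        by (simp add: power2_eq_square algebra_simps)
    qed
    have "(\<Prod>k<p. (x k)\<^sup>2 - (l j)\<^sup>2) = ((x j)\<^sup>2 - (l j)\<^sup>2) * (\<Prod>k\<in>{..<p}-{j}. (x k)\<^sup>2 - (l j)\<^sup>2)"
      using j by (intro prod.remove) auto
    moreover have "F j (x, 0) = w j * (\<Prod>k<p. (x k)\<^sup>2 - (l j)\<^sup>2)"
      by (simp only: F_def det_pencil_diagonal Re_complex_of_real fst_conv snd_conv)
    ultimately show "F j (x, 0) = ?c * ((x j)\<^sup>2 - (l j)\<^sup>2)"
      by (simp add: w_def prod.distrib)
  qed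
  have "\<forall>\<^sub>F e in at_right 0. \<forall>x\<in>K \<inter> {x. x j = l j - t}. - F j (x, e) > 0" if j: "j < p" for j
  proof (rule eventually_positive_on_compact[of _ "\<lambda>z. - F j z"])
    show "compact (K \<inter> {x. x j = l j - t})"
      by (intro compact_Int_closed K closed_Collect_eq continuous_intros continuous_on_product_coordinates)
    show "continuous_on ((K \<inter> {x. x j = l j - t}) \<times> {0..1}) (\<lambda>z. - F j z)"
      by (intro continuous_intros contF)
    fix x assume x: "x \<in> K \<inter> {x. x j = l j - t}"
    have "(x j)\<^sup>2 < (l j)\<^sup>2"
      using x t(1) t(2)[OF j] by (intro power_strict_mono) auto
    then show "- F j (x, 0) > 0"
      using F0[OF j, of x] x by (auto simp: mult_less_0_iff)
  qed
  moreover have "\<forall>\<^sub>F e in at_right 0. \<forall>x\<in>K \<inter> {x. x j = l j + t}. F j (x, e) > 0" if j: "j < p" for j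
  proof (rule eventually_positive_on_compact)
    show "compact (K \<inter> {x. x j = l j + t})"
      by (intro compact_Int_closed K closed_Collect_eq continuous_intros continuous_on_product_coordinates)
    fix x assume x: "x \<in> K \<inter> {x. x j = l j + t}"
    have "(l j)\<^sup>2 < (x j)\<^sup>2"
      using x t(1) l(2)[OF j] by (intro power_strict_mono) auto
    then show "F j (x, 0) > 0"
      using F0[OF j, of x] x by auto
  qed (rule contF)
  ultimately have "\<forall>\<^sub>F e in at_right 0. (\<forall>j\<in>{..<p}. \<forall>x\<in>K \<inter> {x. x j = l j - t}. - F j (x, e) > 0) \<and>
      (\<forall>j\<in>{..<p}. \<forall>x\<in>K \<inter> {x. x j = l j + t}. F j (x, e) > 0) \<and> 0 < e \<and> 2 * real p * e < t"
    using t(1) by (intro eventually_conj eventually_ball_finite small eventually_at_right_less) auto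
  then obtain e where e: "0 < e" "2 * real p * e < t"
    and low: "\<And>j x. j < p \<Longrightarrow> x \<in> K \<Longrightarrow> x j = l j - t \<Longrightarrow> F j (x, e) \<le> 0"
    and high: "\<And>j x. j < p \<Longrightarrow> x \<in> K \<Longrightarrow> x j = l j + t \<Longrightarrow> F j (x, e) \<ge> 0"
    by (force dest!: eventually_happens)
  have "\<exists>x\<in>K. \<forall>j<p. F j (x, e) = 0"
    unfolding K_def
  proof (rule poincare_miranda)
    show "l i - t \<le> l i + t" for i using t(1) by simp
    show "continuous_on {x. \<forall>i. x i \<in> {l i - t..l i + t}} (\<lambda>x. F j (x, e))" for j
      by (rule continuous_on_compose2[OF contF[of UNIV j]]) (auto intro!: continuous_intros)
  qed (use low high in \<open>auto simp: K_def\<close>)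
  then obtain x where x: "x \<in> K" and zero: "\<And>j. j < p \<Longrightarrow> F j (x, e) = 0" by blast
  let ?N = "graph_matrix p E x e"
  have pd: "positive_definite (2 * p) ?N"
  proof (rule positive_definite_graph_matrix[OF E])
    fix k assume "k < p"
    then show "t \<le> x k" using x t(2)[of k] unfolding K_def by (auto dest!: spec[of _ k])
  qed (use e in auto)
  moreover have "det (pencil p ?N (l j)) = 0" if "j < p" for j
  proof -
    have "Re (det (pencil p ?N (l j))) = 0"
      using zero[OF that] w0[OF that] by (simp add: F_def)
    then show ?thesis
      using det_pencil_real[OF graph_matrix_carrier graph_matrix_transpose[of E, OF E], of p x e "l j"] by simp
  qed
  ultimately have "has_symplectic_spectrum p ?N (mset (map l [0..<p]))"
    using Williamson_distinct[OF pd l] by blast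
  then show ?thesis
    using pd e by (intro exI[of _ ?N]) (auto simp: graph_matrix_def)
qed

section \<open>From coupled graphs to matrices\<close>

lemma coupling_card:
  assumes "coupled_graph p G C"
  shows "finite (pverts G)" "finite C" "card C = p"
proof -
  interpret pair_graph G using assms by (simp add: coupled_graph_def)
  show fin: "finite (pverts G)" by (rule pair_finite_verts)
  have C: "partition_on (pverts G) C" "\<forall>c\<in>C. card c = 2" "card (pverts G) = 2 * p"
    using assms by (auto simp: coupled_graph_def)
  show "finite C" by (rule finite_elements[OF fin C(1)])
  have "card (pverts G) = (\<Sum>c\<in>C. card c)"
    unfolding partition_onD1[OF C(1)]
    using partition_onD2[OF C(1)] C(2) by (intro card_Union_disjoint) (auto simp: disjoint_def pairwise_def disjnt_def intro: card_ge_0_finite)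
  then show "card C = p" using C by simp
qed

text \<open>Number the pairs and choose a first member in each: it gets the number of its pair, and the other
  member that number plus \<open>p\<close>. All \<open>2 * p\<close> labels occur, so the labeling is injective by counting.\<close>

lemma representative_labeling_exists:
  assumes G: "coupled_graph p G C"
  shows "\<exists>L. representative_labeling p G C L"
proof -
  have C: "partition_on (pverts G) C" "\<forall>c\<in>C. card c = 2" "card (pverts G) = 2 * p"
    using G by (auto simp: coupled_graph_def)
  note fin = coupling_card[OF G]
  obtain h where h: "bij_betw h C {0..<p}"
    using ex_bij_betw_finite_nat[OF fin(2)] fin(3) by blast
  have "\<forall>c\<in>C. \<exists>x y. c = {x, y} \<and> x \<noteq> y" using C(2) by (simp add: card_2_iff)
  then obtain f g where fg: "\<And>c. c \<in> C \<Longrightarrow> c = {f c, g c} \<and> f c \<noteq> g c" by metis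
  define cell where "cell v = (THE c. c \<in> C \<and> v \<in> c)" for v
  have cell: "cell v = c" if "c \<in> C" "v \<in> c" for v c
    unfolding cell_def using that partition_onD2[OF C(1)]
    by (intro the_equality) (auto simp: disjoint_def)
  define L where "L v = h (cell v) + (if v = f (cell v) then 0 else p)" for v
  have Lc: "L ` c = {h c, h c + p}" if "c \<in> C" for c
  proof -
    have "L ` {f c, g c} = {L (f c), L (g c)}" by simp
    moreover have "cell (f c) = c" "cell (g c) = c" using fg[OF that] cell[OF that] by blast+
    ultimately show ?thesis using fg[OF that] by (metis L_def add_0_right)
  qed
  have "L ` pverts G = (\<Union>c\<in>C. L ` c)"
    unfolding partition_onD1[OF C(1)] by blast
  also have "\<dots> = (\<Union>k\<in>h ` C. {k, k + p})" using Lc by auto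
  also have "\<dots> = {..<2 * p}"
  proof -
    have "i \<in> (\<Union>k\<in>{0..<p}. {k, k + p})" if "i < 2 * p" for i
      using that by (cases "i < p") (auto intro: bexI[of _ "i - p"])
    then show ?thesis using h by (auto simp: bij_betw_def)
  qed
  finally have im: "L ` pverts G = {..<2 * p}" .
  then have "inj_on L (pverts G)"
    using fin(1) C(3) by (intro eq_card_imp_inj_on) auto
  then have "bij_betw L (pverts G) {..<2 * p}" using im by (simp add: bij_betw_def)
  moreover have "\<exists>k<p. L ` c = {k, k + p}" if "c \<in> C" for c
    using Lc[OF that] h that by (auto simp: bij_betw_def intro!: exI[of _ "h c"])
  ultimately show ?thesis unfolding representative_labeling_def by blast
qed

lemma coupled_graph_allows_distinct_spectrum:
  assumes G: "coupled_graph p G C" and "size \<Lambda> = p" and pos: "\<forall>x \<in># \<Lambda>. x > 0"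
    and simple: "\<forall>x \<in># \<Lambda>. count \<Lambda> x = 1"
  shows "allows_symplectic_spectrum p G C \<Lambda>"
proof -
  interpret pair_graph G using G by (simp add: coupled_graph_def)
  obtain xs where xs: "mset xs = \<Lambda>" using ex_mset by blast
  have len: "length xs = p" using xs assms(2) by (metis size_mset)
  have "distinct xs"
    using simple xs by (auto simp: distinct_count_atmost_1 count_eq_zero_iff)
  then have inj: "inj_on ((!) xs) {..<p}" using len by (auto intro: inj_on_nth)
  have xs_map: "map ((!) xs) [0..<p] = xs" using len map_nth by blast
  obtain L where L: "representative_labeling p G C L" using representative_labeling_exists[OF G] by blast
  have bij: "bij_betw L (pverts G) {..<2 * p}" using L by (simp add: representative_labeling_def)
  define E where "E i j \<longleftrightarrow> (inv_into (pverts G) L i, inv_into (pverts G) L j) \<in> parcs G" for i j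
  have E: "E i j \<longleftrightarrow> E j i" for i j
    using pair_sym_arcs by (auto simp: E_def symmetric_def sym_def)
  have xs_pos: "xs ! j > 0" if "j < p" for j
    using pos xs that len by (metis nth_mem set_mset_mset)
  obtain N where N: "positive_definite (2 * p) N"
    "\<And>i j. i < 2 * p \<Longrightarrow> j < 2 * p \<Longrightarrow> i \<noteq> j \<Longrightarrow> (N $$ (i, j) \<noteq> 0 \<longleftrightarrow> E i j)"
    "has_symplectic_spectrum p N (mset (map ((!) xs) [0..<p]))"
    using distinct_symplectic_spectrum_realizable[of E "(!) xs" p, OF E inj xs_pos] by blast
  have "N \<in> S_plus p G L"
    unfolding S_plus_def
  proof (safe intro!: N(1))
    fix u v assume uv: "u \<in> pverts G" "v \<in> pverts G" "u \<noteq> v"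
    have "L u < 2 * p" "L v < 2 * p" "L u \<noteq> L v" "inv_into (pverts G) L (L u) = u" "inv_into (pverts G) L (L v) = v"
      using bij uv by (auto simp: bij_betw_def inj_on_def inv_into_f_f)
    then have eq: "N $$ (L u, L v) \<noteq> 0 \<longleftrightarrow> (u, v) \<in> parcs G"
      using N(2)[of "L u" "L v"] by (simp add: E_def)
    show "(u, v) \<in> parcs G" if "N $$ (L u, L v) \<noteq> 0" using eq that by simp
    show False if "N $$ (L u, L v) = 0" "(u, v) \<in> parcs G" using eq that by simp
  qed
  then show ?thesis
    using L N(3) xs xs_map unfolding allows_symplectic_spectrum_def by metis
qed

lemma size_symplectic_spectrum: "has_symplectic_spectrum p N \<Lambda> \<Longrightarrow> size \<Lambda> = p"
  by (auto simp: has_symplectic_spectrum_def diag_mat_def)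

text \<open>As the maximum in \<open>M_Sp\<close> is taken by \<open>Max\<close>, it bounds its members only because their set is
  finite: a multiplicity is at most \<open>p\<close>.\<close>

lemma count_le_M_Sp:
  assumes "representative_labeling p G C L" "N \<in> S_plus p G L" "has_symplectic_spectrum p N \<Lambda>" "x \<in># \<Lambda>"
  shows "count \<Lambda> x \<le> M_Sp p G C"
  unfolding M_Sp_def
proof (rule Max_ge)
  let ?A = "{count \<Lambda> x | L N \<Lambda> x. representative_labeling p G C L \<and> N \<in> S_plus p G L \<and>
           has_symplectic_spectrum p N \<Lambda> \<and> x \<in># \<Lambda>}"
  have "?A \<subseteq> {..p}"
    using size_symplectic_spectrum count_le_size by fastforce
  then show "finite ?A" by (rule finite_subset) simp
  show "count \<Lambda> x \<in> ?A" using assms by blast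
qed

lemma allows_iff_distinct:
  assumes G: "coupled_graph p G C" and M: "M_Sp p G C = 1"
    and \<Lambda>: "size \<Lambda> = p" "\<forall>x \<in># \<Lambda>. x > 0"
  shows "allows_symplectic_spectrum p G C \<Lambda> \<longleftrightarrow> (\<forall>x \<in># \<Lambda>. count \<Lambda> x = 1)"
proof
  assume "allows_symplectic_spectrum p G C \<Lambda>"
  then show "\<forall>x \<in># \<Lambda>. count \<Lambda> x = 1"
    using count_le_M_Sp[of p G C _ _ \<Lambda>] M unfolding allows_symplectic_spectrum_def
    by (metis count_greater_eq_one_iff le_antisym)
qed (use coupled_graph_allows_distinct_spectrum[OF G \<Lambda>] in blast)

section \<open>Simplicity of symplectic eigenvalues\<close>

lemma Omega_square: "Omega p * (- Omega p) = 1\<^sub>m (2 * p)"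
proof -
  have "Omega p * Omega p = four_block_mat (- 1\<^sub>m p) (0\<^sub>m p p) (0\<^sub>m p p) (- 1\<^sub>m p)"
    unfolding Omega_def by (subst mult_four_block_mat[of _ p p _ p _ p]) auto
  also have "\<dots> = - 1\<^sub>m (2 * p)"
    by (intro eq_matI) auto
  finally show ?thesis
    by (simp add: uminus_mult_right_mat)
qed

text \<open>The transpose of a symplectic matrix is invertible, with inverse \<open>- Omega S Omega\<close>.\<close>

lemma symplectic_columns_separate:
  assumes S: "symplectic p S" and u: "u \<in> carrier_vec (2 * p)"
    and 0: "\<And>k. k < 2 * p \<Longrightarrow> col S k \<bullet> u = 0"
  shows "u = 0\<^sub>v (2 * p)"
proof -
  have SC: "S \<in> carrier_mat (2 * p) (2 * p)" and eq: "transpose_mat S * Omega p * S = Omega p"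
    using S by (auto simp: symplectic_def)
  have T: "transpose_mat S \<in> carrier_mat (2 * p) (2 * p)" using SC by simp
  have O: "- Omega p \<in> carrier_mat (2 * p) (2 * p)" by simp
  define R where "R = Omega p * S * (- Omega p)"
  have RC: "R \<in> carrier_mat (2 * p) (2 * p)"
    unfolding R_def using SC by (intro mult_carrier_mat[OF mult_carrier_mat O]) auto
  have "transpose_mat S * R = transpose_mat S * (Omega p * S) * (- Omega p)"
    unfolding R_def using SC by (intro assoc_mult_mat[symmetric, OF T _ O] mult_carrier_mat) auto
  also have "transpose_mat S * (Omega p * S) = Omega p"
    using eq assoc_mult_mat[OF T _ SC, of "Omega p"] by simp
  finally have "R * transpose_mat S = 1\<^sub>m (2 * p)"
    using mat_mult_left_right_inverse[OF T RC] by (simp add: Omega_square)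
  moreover have "transpose_mat S *\<^sub>v u = 0\<^sub>v (2 * p)"
    using SC 0 by (intro eq_vecI) auto
  ultimately have "1\<^sub>m (2 * p) *\<^sub>v u = R *\<^sub>v 0\<^sub>v (2 * p)"
    using assoc_mult_mat_vec[OF RC T u] by simp
  also have "\<dots> = 0\<^sub>v (2 * p)"
    using RC by (intro eq_vecI) auto
  finally show ?thesis using u by simp
qed

text \<open>Pairing both sides of the two eigenpair equations with an arbitrary column of \<open>S\<close> gives the same
  entry of the normal form, and the columns of \<open>S\<close> separate vectors.\<close>

lemma symplectic_diagonalization_eigenpair:
  assumes S: "symplectic p S" and N: "N \<in> carrier_mat (2 * p) (2 * p)"
    and D: "D \<in> carrier_mat p p" "diagonal_mat D"
    and eq: "transpose_mat S * N * S = four_block_mat D (0\<^sub>m p p) (0\<^sub>m p p) D" and i: "i < p"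
  shows "symplectic_eigenpair p N (D $$ (i, i)) (col S i) (col S (i + p))"
proof -
  have SC: "S \<in> carrier_mat (2 * p) (2 * p)" and om: "transpose_mat S * Omega p * S = Omega p"
    using S by (auto simp: symplectic_def)
  have cv: "col S k \<in> carrier_vec (2 * p)" for k using SC by (auto intro!: carrier_vecI)
  have Nc: "N *\<^sub>v col S k \<in> carrier_vec (2 * p)" for k
    using N cv by (rule mult_mat_vec_carrier)
  have formO: "col S k \<bullet> (Omega p *\<^sub>v col S j) = Omega p $$ (k, j)" if "k < 2 * p" "j < 2 * p" for k j
    using congruence_entry[OF SC _ that, of "Omega p"] om by simp
  have formN: "col S k \<bullet> (N *\<^sub>v col S j) = four_block_mat D (0\<^sub>m p p) (0\<^sub>m p p) D $$ (k, j)"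
    if "k < 2 * p" "j < 2 * p" for k j
    using congruence_entry[OF SC N that] eq by simp
  have D0: "D $$ (k, j) = 0" if "k < p" "j < p" "k \<noteq> j" for k j
    using D that by (auto simp: diagonal_mat_def)
  have eq: "v = w" if "v - w = 0\<^sub>v (2 * p)" "v \<in> carrier_vec (2 * p)" "w \<in> carrier_vec (2 * p)"
    for v w :: "real vec"
  proof (rule eq_vecI)
    fix k assume "k < dim_vec w"
    then have "v $ k - w $ k = (v - w) $ k" "k < 2 * p" using that(2,3) by auto
    then have "v $ k - w $ k = 0\<^sub>v (2 * p) $ k" by (simp only: that(1))
    then show "v $ k = w $ k" using \<open>k < 2 * p\<close> by simp
  qed (use that in auto)
  have 1: "N *\<^sub>v col S i - D $$ (i, i) \<cdot>\<^sub>v (Omega p *\<^sub>v col S (i + p)) = 0\<^sub>v (2 * p)"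
    using i D D0 cv Nc
    by (intro symplectic_columns_separate[OF S])
       (auto simp: scalar_prod_minus_distrib[of _ "2*p"] scalar_prod_smult_distrib[of _ "2*p"] formO formN Omega_index)
  have 2: "N *\<^sub>v col S (i + p) - (- D $$ (i, i)) \<cdot>\<^sub>v (Omega p *\<^sub>v col S i) = 0\<^sub>v (2 * p)"
    using i D D0 cv Nc
    by (intro symplectic_columns_separate[OF S])
       (auto simp: scalar_prod_minus_distrib[of _ "2*p"] scalar_prod_smult_distrib[of _ "2*p"] formO formN Omega_index)
  show ?thesis
    unfolding symplectic_eigenpair_def
    using eq[OF 1 Nc] eq[OF 2 Nc] cv by (metis Omega_mult_carrier smult_carrier_vec)
qed

text \<open>A criterion for simplicity: if a kernel vector of the pencil is determined by one coordinate, the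
  kernel is at most one-dimensional. Two occurrences of \<open>l\<close> on the diagonal would give two
  eigenpairs that span the same complex line, against the symplectic orthogonality of the columns
  of \<open>S\<close> that belong to different pairs.\<close>

lemma multiplicity_le_1I:
  assumes N: "N \<in> carrier_mat (2 * p) (2 * p)" and spec: "has_symplectic_spectrum p N \<Lambda>"
    and r: "r < 2 * p"
    and ker: "\<And>X. (\<And>i. i < 2 * p \<Longrightarrow> (\<Sum>j<2*p. pencil p N l $$ (i, j) * X j) = 0) \<Longrightarrow> X r = 0 \<Longrightarrow>
        (\<And>j. j < 2 * p \<Longrightarrow> X j = 0)"
  shows "count \<Lambda> l \<le> 1"
proof (rule ccontr)
  assume many: "\<not> count \<Lambda> l \<le> 1"
  obtain S D where S: "symplectic p S" and D: "D \<in> carrier_mat p p" "diagonal_mat D"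
    and eq: "transpose_mat S * N * S = four_block_mat D (0\<^sub>m p p) (0\<^sub>m p p) D"
    and \<Lambda>: "\<Lambda> = mset (diag_mat D)"
    using spec unfolding has_symplectic_spectrum_def by blast
  have "\<Lambda> = mset (map (\<lambda>i. D $$ (i, i)) [0..<p])"
    using \<Lambda> D by (simp add: diag_mat_def)
  then have "count \<Lambda> l = card {i. i < p \<and> D $$ (i, i) = l}"
    by (simp only: count_mset count_list_eq_length_filter length_filter_conv_card) (rule arg_cong[of _ _ card], auto)
  then obtain i j where ij: "i < p" "j < p" "i \<noteq> j" "D $$ (i, i) = l" "D $$ (j, j) = l"
    using many card_le_Suc0_iff_eq[of "{i. i < p \<and> D $$ (i, i) = l}"] by auto
  have SC: "S \<in> carrier_mat (2 * p) (2 * p)" and om: "transpose_mat S * Omega p * S = Omega p"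
    using S by (auto simp: symplectic_def)
  have cv: "col S k \<in> carrier_vec (2 * p)" for k using SC by (auto intro!: carrier_vecI)
  have formO: "col S k \<bullet> (Omega p *\<^sub>v col S j) = Omega p $$ (k, j)" if "k < 2 * p" "j < 2 * p" for k j
    using congruence_entry[OF SC _ that, of "Omega p"] om by simp
  define X where "X i s = Complex (col S i $ s) (col S (i + p) $ s)" for i s
  have kerX: "(\<Sum>s<2*p. pencil p N l $$ (t, s) * X k s) = 0" if "t < 2 * p" "k \<in> {i, j}" for t k
    using symplectic_diagonalization_eigenpair[OF S N D eq, of k] pencil_kernel[OF N cv cv, of l k "k + p"]
      ij that unfolding X_def by auto
  have nz: "X k r \<noteq> 0" if k: "k \<in> {i, j}" for k
  proof
    assume "X k r = 0"
    then have "X k s = 0" if "s < 2 * p" for s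
      using ker[of "X k"] kerX k that by blast
    then have "col S k = 0\<^sub>v (2 * p)"
      using SC by (intro eq_vecI) (auto simp: X_def complex_eq_iff)
    then show False
      using formO[of k "k + p"] ij k cv[of "k + p"] by (auto simp: Omega_index)
  qed
  define q where "q = X i r / X j r"
  have "X i s - q * X j s = 0" if s: "s < 2 * p" for s
  proof (rule ker[OF _ _ s])
    fix t assume t: "t < 2 * p"
    show "(\<Sum>s<2*p. pencil p N l $$ (t, s) * (X i s - q * X j s)) = 0"
      using kerX[OF t, of i] kerX[OF t, of j]
      by (simp add: algebra_simps sum_subtractf mult.left_commute[of _ q] flip: sum_distrib_left)
  next
    show "X i r - q * X j r = 0" using nz by (simp add: q_def)
  qed
  then have "col S i $ s = Re q * (col S j $ s) - Im q * (col S (j + p) $ s)" if "s < 2 * p" for s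
    using that by (fastforce simp: X_def complex_eq_iff)
  then have "col S i = Re q \<cdot>\<^sub>v col S j - Im q \<cdot>\<^sub>v col S (j + p)"
    using SC by (intro eq_vecI) auto
  then have "col S i \<bullet> (Omega p *\<^sub>v col S (i + p)) =
      Re q * (col S j \<bullet> (Omega p *\<^sub>v col S (i + p))) - Im q * (col S (j + p) \<bullet> (Omega p *\<^sub>v col S (i + p)))"
    using cv by (simp add: minus_scalar_prod_distrib[of _ "2*p"] smult_scalar_prod_distrib[of _ "2*p"])
  then show False
    using ij by (simp add: formO Omega_index)
qed

section \<open>Kernel vectors on caterpillars\<close>

lemma closed_vertex_walk_imp_cycle:
  assumes "u \<in> pverts G" "set (vwalk_arcs (u # vs @ [u])) \<subseteq> parcs G" "distinct (u # vs)"
  shows "pre_digraph.cycle (with_proj G) (vwalk_arcs (u # vs @ [u]))"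
proof -
  have cas: "pcas x (vwalk_arcs (x # ws)) (last (x # ws))" for x and ws :: "'a list"
    by (induction ws arbitrary: x) auto
  have verts: "pawalk_verts x (vwalk_arcs (x # ws)) = x # ws" for x and ws :: "'a list"
    by (induction ws arbitrary: x) auto
  have "vwalk_arcs (u # vs @ [u]) \<noteq> []" by (cases vs) auto
  then show ?thesis
    unfolding pre_digraph.cycle_def pre_digraph.awalk_def cas_with_proj_eq awalk_verts_with_proj_eq
    using assms cas[of u "vs @ [u]"] verts[of u "vs @ [u]"] by (intro exI[of _ u]) auto
qed

text \<open>Acyclicity for paths given as vertex lists: the arc back to the start would turn the arcs of the
  path into a cycle of length at least \<open>3\<close>.\<close>

lemma tree_no_closed_path:
  assumes tree: "undirected_tree G" and vs: "distinct vs" "3 \<le> length vs" "set (vwalk_arcs vs) \<subseteq> parcs G"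
  shows "(last vs, hd vs) \<notin> parcs G"
proof
  assume closing: "(last vs, hd vs) \<in> parcs G"
  obtain u ws where uw: "vs = u # ws" using vs(2) by (cases vs) auto
  interpret pair_graph G using tree by (simp add: undirected_tree_def)
  have arcs: "set (vwalk_arcs (u # ws @ [u])) \<subseteq> parcs G"
    using set_vwalk_arcs_snoc[of "u # ws" u] closing vs(3) uw by auto
  have "u \<in> pverts G" using closing in_arcsD2 uw by auto
  then have "pre_digraph.cycle (with_proj G) (vwalk_arcs (u # ws @ [u]))"
    using closed_vertex_walk_imp_cycle[OF _ arcs] vs(1) uw by blast
  moreover have "length (vwalk_arcs (u # ws @ [u])) \<ge> 3"
    using vs(2) vwalk_length_simp[of "u # ws @ [u]"] uw
    unfolding vwalk_length_def by (simp del: vwalk_arcs.simps)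
  ultimately show False using tree by (auto simp: undirected_tree_def)
qed

lemma subpath:
  assumes P: "vpath P (with_proj G)" and ij: "i \<le> j" "j < length P"
  obtains vs where "hd vs = P ! i" "last vs = P ! j" "set vs \<subseteq> set P" "distinct vs"
    "length vs = Suc (j - i)" "set (vwalk_arcs vs) \<subseteq> parcs G"
proof
  let ?vs = "take (Suc (j - i)) (drop i P)"
  have P': "distinct P" "set (vwalk_arcs P) \<subseteq> parcs G"
    using P by (auto simp: vpath_def vwalk_def)
  show "hd ?vs = P ! i" using ij by (simp add: hd_drop_conv_nth)
  show len: "length ?vs = Suc (j - i)" using ij by simp
  show "last ?vs = P ! j" using ij len by (subst last_conv_nth) (auto simp del: length_take)
  show "set ?vs \<subseteq> set P" by (meson order_trans set_drop_subset set_take_subset)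
  show "distinct ?vs" using P'(1) by simp
  have "set (vwalk_arcs ?vs) \<subseteq> set (vwalk_arcs (drop i P))"
    using set_vwalk_arcs_append1[of ?vs "drop (Suc (j - i)) (drop i P)"] by (simp only: append_take_drop_id)
  also have "\<dots> \<subseteq> set (vwalk_arcs P)"
    using set_vwalk_arcs_append2[of "drop i P" "take i P"] by simp
  finally show "set (vwalk_arcs ?vs) \<subseteq> parcs G" using P'(2) by blast
qed

lemma tree_path_no_chord:
  assumes tree: "undirected_tree G" and P: "vpath P (with_proj G)"
    and ij: "i < length P" "j < length P" and arc: "(P ! i, P ! j) \<in> parcs G"
  shows "i = Suc j \<or> j = Suc i"
proof -
  interpret pair_graph G using tree by (simp add: undirected_tree_def)
  have sym: "(y, x) \<in> parcs G" if "(x, y) \<in> parcs G" for x y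
    using pair_sym_arcs that by (auto simp: symmetric_def sym_def)
  have no: "\<not> Suc i < j" if "j < length P" "(P ! j, P ! i) \<in> parcs G" for i j
  proof
    assume "Suc i < j"
    obtain vs where "hd vs = P ! i" "last vs = P ! j" "set vs \<subseteq> set P" "distinct vs"
      "length vs = Suc (j - i)" "set (vwalk_arcs vs) \<subseteq> parcs G"
      using subpath[OF P, of i j] \<open>Suc i < j\<close> \<open>j < length P\<close> by auto
    moreover have "3 \<le> Suc (j - i)" using \<open>Suc i < j\<close> by linarith
    ultimately show False
      using tree_no_closed_path[OF tree, of vs] that by simp
  qed
  have "i \<noteq> j" using arc pair_no_loops by force
  then show ?thesis using no[of j i] no[of i j] ij arc sym[OF arc] by linarith
qed

lemma vwalk_arcs_Cons: "vs \<noteq> [] \<Longrightarrow> vwalk_arcs (u # vs) = (u, hd vs) # vwalk_arcs vs"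
  by (cases vs) auto

text \<open>The vertices off the spine are leaves. Two neighbors on the spine close a cycle with the piece of
  the spine between them. A neighbor off the spine is itself attached to the spine, so it
  closes a cycle as well, which is a triangle if both vertices hang at the same spine vertex.\<close>

lemma caterpillar_leaf:
  assumes tree: "undirected_tree G" and P: "vpath P (with_proj G)"
    and dom: "\<forall>v \<in> pverts G - set P. \<exists>u \<in> set P. (v, u) \<in> parcs G"
    and v: "v \<in> pverts G - set P" and arcs: "(v, x) \<in> parcs G" "(v, y) \<in> parcs G"
  shows "x = y"
proof -
  interpret pair_graph G using tree by (simp add: undirected_tree_def)
  have sym: "(y, x) \<in> parcs G" if "(x, y) \<in> parcs G" for x y
    using pair_sym_arcs that by (auto simp: symmetric_def sym_def)
  have no2: "\<not> i < j" if "j < length P" "(v, P ! i) \<in> parcs G" "(v, P ! j) \<in> parcs G" for i j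
  proof
    assume "i < j"
    obtain vs where vs: "hd vs = P ! i" "last vs = P ! j" "set vs \<subseteq> set P" "distinct vs"
      "length vs = Suc (j - i)" "set (vwalk_arcs vs) \<subseteq> parcs G"
      using subpath[OF P, of i j] \<open>i < j\<close> \<open>j < length P\<close> by auto
    moreover have "vs \<noteq> []" "v \<notin> set vs" "Suc 0 \<le> j - i" using vs v \<open>i < j\<close> by auto
    ultimately show False
      using tree_no_closed_path[OF tree, of "v # vs"] \<open>i < j\<close> that v sym[OF that(3)]
      by (auto simp: vwalk_arcs_Cons)
  qed
  have no3: "\<not> i \<le> j" if "j < length P" "(s, t) \<in> parcs G" "s \<notin> set P" "t \<notin> set P"
      "(s, P ! i) \<in> parcs G" "(t, P ! j) \<in> parcs G" for i j s t
  proof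
    assume "i \<le> j"
    obtain vs where vs: "hd vs = P ! i" "last vs = P ! j" "set vs \<subseteq> set P" "distinct vs"
      "length vs = Suc (j - i)" "set (vwalk_arcs vs) \<subseteq> parcs G"
      using subpath[OF P, of i j] \<open>i \<le> j\<close> \<open>j < length P\<close> by auto
    have "vs \<noteq> []" "s \<noteq> t" using vs that(2) pair_no_loops by force+
    then show False
      using tree_no_closed_path[OF tree, of "t # s # vs"] vs \<open>i \<le> j\<close> that sym[OF that(2)] sym[OF that(6)]
      by (auto simp: vwalk_arcs_Cons)
  qed
  have inP: "z \<in> set P" if vz: "(v, z) \<in> parcs G" for z
  proof (rule ccontr)
    assume z: "z \<notin> set P"
    obtain i where i: "i < length P" "(v, P ! i) \<in> parcs G"
      using dom v by (metis in_set_conv_nth)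
    obtain j where j: "j < length P" "(z, P ! j) \<in> parcs G"
      using dom z in_arcsD2[OF vz] by (metis Diff_iff in_set_conv_nth)
    show False
      using no3[OF j(1) vz _ z i(2) j(2)] no3[OF i(1) sym[OF vz] z _ j(2) i(2)] v by auto
  qed
  obtain i j where "i < length P" "x = P ! i" "j < length P" "y = P ! j"
    using inP arcs by (metis in_set_conv_nth)
  then show ?thesis
    using no2[of i j] no2[of j i] arcs by (metis linorder_neqE_nat)
qed

text \<open>A kernel vector of a matrix with the pattern of a caterpillar is determined by its value at the
  first spine vertex, provided that the leaves have nonzero diagonal entries. A leaf at a spine
  vertex where the vector vanishes also carries the value \<open>0\<close>, by the row of the leaf. So in the row
  of the last spine vertex known to carry \<open>0\<close>, the only term left is that of the next spine vertex,
  and its coefficient is not \<open>0\<close>.\<close>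

lemma caterpillar_kernel_vector:
  fixes H :: "'v \<Rightarrow> 'v \<Rightarrow> 'a::idom" and x :: "'v \<Rightarrow> 'a"
  assumes tree: "undirected_tree G" and P: "vpath P (with_proj G)"
    and dom: "\<forall>v \<in> pverts G - set P. \<exists>u \<in> set P. (v, u) \<in> parcs G"
    and H: "\<And>u v. u \<in> pverts G \<Longrightarrow> v \<in> pverts G \<Longrightarrow> u \<noteq> v \<Longrightarrow> H u v \<noteq> 0 \<longleftrightarrow> (u, v) \<in> parcs G"
    and diag: "\<And>v. v \<in> pverts G - set P \<Longrightarrow> H v v \<noteq> 0"
    and ker: "\<And>v. v \<in> pverts G \<Longrightarrow> (\<Sum>w\<in>pverts G. H v w * x w) = 0"
    and x0: "x (hd P) = 0"
    and v: "v \<in> pverts G"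
  shows "x v = 0"
proof -
  interpret pair_graph G using tree by (simp add: undirected_tree_def)
  have sym: "(y, x) \<in> parcs G" if "(x, y) \<in> parcs G" for x y
    using pair_sym_arcs that by (auto simp: symmetric_def sym_def)
  have PV: "set P \<subseteq> pverts G" "P \<noteq> []" "distinct P" and steps: "set (vwalk_arcs P) \<subseteq> parcs G"
    using P by (auto simp: vpath_def vwalk_def)
  have single: "H v w * x w = 0" if "v \<in> pverts G" "w \<in> pverts G"
    "\<And>u. u \<in> pverts G \<Longrightarrow> u \<noteq> w \<Longrightarrow> H v u * x u = 0" for v w
  proof -
    have "(\<Sum>u\<in>pverts G. H v u * x u) = (\<Sum>u\<in>{w}. H v u * x u)"
      using that by (intro sum.mono_neutral_right) auto
    then show ?thesis using ker[OF that(1)] by simp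
  qed
  have leaf0: "x w = 0" if w: "w \<in> pverts G - set P" "(w, u) \<in> parcs G" "x u = 0" for w u
  proof -
    have "H w w * x w = 0"
    proof (rule single)
      fix t assume t: "t \<in> pverts G" "t \<noteq> w"
      show "H w t * x t = 0"
        using H[of w t] t w caterpillar_leaf[OF tree P dom w(1) w(2), of t] by auto
    qed (use w in auto)
    then show ?thesis using diag[OF w(1)] by simp
  qed
  have spine: "x (P ! i) = 0" if "i < length P" for i
    using that
  proof (induction i rule: less_induct)
    case (less i)
    show ?case
    proof (cases i)
      case 0
      then show ?thesis using x0 PV by (simp add: hd_conv_nth)
    next
      case (Suc k)
      have k: "k < length P" "P ! k \<in> pverts G" "P ! i \<in> pverts G" using less.prems Suc PV by auto
      have "H (P ! k) (P ! i) * x (P ! i) = 0"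
      proof (rule single[OF k(2,3)])
        fix t assume t: "t \<in> pverts G" "t \<noteq> P ! i"
        show "H (P ! k) t * x t = 0"
        proof (cases "t \<in> set P")
          case True
          then obtain m where m: "m < length P" "t = P ! m" by (metis in_set_conv_nth)
          show ?thesis
          proof (cases "m \<le> k")
            case True
            then show ?thesis using less.IH[of m] m Suc by simp
          next
            case False
            then have "(P ! k, t) \<notin> parcs G" "P ! k \<noteq> t"
              using tree_path_no_chord[OF tree P k(1) m(1)] m t Suc PV(3) k(1)
              by (auto simp: nth_eq_iff_index_eq)
            then show ?thesis using H[OF k(2) t(1)] by auto
          qed
        next
          case False
          then have "P ! k \<noteq> t" using k by auto
          then show ?thesis
            using H[OF k(2) t(1)] leaf0[of t "P ! k"] sym False t less.IH[of k] Suc k(1) by auto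
        qed
      qed
      moreover have "(P ! k, P ! i) \<in> parcs G"
      proof -
        have "P = take k P @ P ! k # P ! i # drop (Suc i) P"
          using less.prems Suc by (metis Cons_nth_drop_Suc Suc_lessD append_take_drop_id)
        then have "set (vwalk_arcs (P ! k # P ! i # drop (Suc i) P)) \<subseteq> set (vwalk_arcs P)"
          by (metis set_vwalk_arcs_append2)
        then show ?thesis using steps by auto
      qed
      moreover from this have "P ! k \<noteq> P ! i" using pair_no_loops by force
      ultimately show ?thesis using H[OF k(2,3)] by auto
    qed
  qed
  show ?thesis
  proof (cases "v \<in> set P")
    case True
    then show ?thesis using spine by (metis in_set_conv_nth)
  next
    case False
    then obtain u where "u \<in> set P" "(v, u) \<in> parcs G" using dom v by auto
    then show ?thesis using leaf0[of v u] spine False v by (metis DiffI in_set_conv_nth)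
  qed
qed

section \<open>Caterpillars coupled by a perfect matching\<close>

lemma perfect_matching_edge:
  assumes "perfect_matching G M" "e \<in> M"
  obtains u v where "e = {u, v}" "(u, v) \<in> parcs G"
proof -
  have "M \<subseteq> {{u, v} | u v. (u, v) \<in> parcs G}" using assms(1) by (simp add: perfect_matching_def)
  from subsetD[OF this assms(2)] show ?thesis using that by (elim CollectE exE conjE)
qed

lemma perfect_matching_covers:
  assumes "perfect_matching G M" "v \<in> pverts G"
  shows "\<exists>!e. e \<in> M \<and> v \<in> e"
  using assms by (simp add: perfect_matching_def)

lemma perfect_matching_coupling:
  assumes G: "pair_graph G" and M: "perfect_matching G M"
  shows "coupled_graph (card M) G M"
proof -
  interpret pair_graph G by fact
  have edge: "\<exists>u v. e = {u, v} \<and> (u, v) \<in> parcs G \<and> u \<noteq> v" if e: "e \<in> M" for e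
  proof -
    obtain u v where "e = {u, v}" "(u, v) \<in> parcs G"
      by (rule perfect_matching_edge[OF M e])
    moreover from this have "u \<noteq> v" using pair_no_loops[of "(u, v)"] by simp
    ultimately show ?thesis by blast
  qed
  have card: "card e = 2" if "e \<in> M" for e using edge[OF that] by auto
  have sub: "e \<subseteq> pverts G" if "e \<in> M" for e
    using edge[OF that] in_arcsD1 in_arcsD2 by auto
  have disj: "disjoint M"
    unfolding disjoint_def
  proof (intro ballI impI)
    fix c d assume "c \<in> M" "d \<in> M" "c \<noteq> d"
    then show "c \<inter> d = {}" using perfect_matching_covers[OF M] sub by blast
  qed
  have part: "partition_on (pverts G) M"
    unfolding partition_on_def
  proof (intro conjI disj)
    show "\<Union> M = pverts G" using perfect_matching_covers[OF M] sub by blast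
    show "{} \<notin> M" using card by force
  qed
  have "card (pverts G) = (\<Sum>c\<in>M. card c)"
    unfolding partition_onD1[OF part]
    using disj card by (intro card_Union_disjoint) (auto simp: disjoint_def pairwise_def disjnt_def intro: card_ge_0_finite)
  then show ?thesis
    using part card G by (simp add: coupled_graph_def)
qed

text \<open>Two vertices in a common pair are matched, hence adjacent. Adding \<open>\<i> l Omega\<close> to \<open>N\<close> therefore changes
  entries at edges only, and an entry at an edge keeps its nonzero real part. So the pencil still has
  the pattern of the caterpillar, and its diagonal is that of \<open>N\<close>, which is positive.\<close>

lemma caterpillar_multiplicity_le_1:
  assumes cat: "caterpillar G" and M: "perfect_matching G M"
    and L: "representative_labeling p G M L" and N: "N \<in> S_plus p G L"
    and spec: "has_symplectic_spectrum p N \<Lambda>"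
  shows "count \<Lambda> l \<le> 1"
proof -
  have tree: "undirected_tree G" using cat by (simp add: caterpillar_def)
  interpret pair_graph G using tree by (simp add: undirected_tree_def)
  obtain P where P: "vpath P (with_proj G)"
    and dom: "\<forall>v \<in> pverts G - set P. \<exists>u \<in> set P. (v, u) \<in> parcs G"
    using cat by (auto simp: caterpillar_def)
  have hdP: "hd P \<in> pverts G" using P by (auto simp: vpath_def vwalk_def)
  have bij: "bij_betw L (pverts G) {..<2 * p}"
    and pairs: "\<forall>c \<in> M. \<exists>k<p. L ` c = {k, k + p}"
    using L by (auto simp: representative_labeling_def)
  have pd: "positive_definite (2 * p) N"
    and pat: "\<And>u v. u \<in> pverts G \<Longrightarrow> v \<in> pverts G \<Longrightarrow> u \<noteq> v \<Longrightarrow> (N $$ (L u, L v) \<noteq> 0 \<longleftrightarrow> (u, v) \<in> parcs G)"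
    using N by (auto simp: S_plus_def)
  have NC: "N \<in> carrier_mat (2 * p) (2 * p)" using pd by (simp add: positive_definite_def)
  have Llt: "L v < 2 * p" if "v \<in> pverts G" for v using bij that by (auto simp: bij_betw_def)
  have Linj: "L u = L v \<longleftrightarrow> u = v" if "u \<in> pverts G" "v \<in> pverts G" for u v
    using bij that by (auto simp: bij_betw_def inj_on_def)
  have diag: "N $$ (i, i) > 0" if "i < 2 * p" for i
  proof -
    have "unit_vec (2 * p) i \<bullet> (N *\<^sub>v unit_vec (2 * p) i) > 0"
      using pd that unfolding positive_definite_def by (metis unit_vec_carrier unit_vec_nonzero)
    then show ?thesis using that NC by (simp add: scalar_prod_left_unit[of _ "2*p"])
  qed
  have matched: "(u, v) \<in> parcs G" if uv: "u \<in> pverts G" "v \<in> pverts G" "L v = L u + p" for u v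
  proof -
    have "p > 0" using Llt[OF uv(1)] by auto
    then have ne: "u \<noteq> v" using uv(3) by auto
    obtain c where c: "c \<in> M" "u \<in> c" using perfect_matching_covers[OF M uv(1)] by blast
    obtain k where k: "k < p" "L ` c = {k, k + p}" using pairs c(1) by blast
    have "L u < p" using Llt[OF uv(2)] uv(3) by simp
    then have "L u = k" using k c(2) by fastforce
    then have "L v \<in> L ` c" using k uv(3) by simp
    moreover obtain x y where xy: "c = {x, y}" "(x, y) \<in> parcs G"
      by (rule perfect_matching_edge[OF M c(1)])
    moreover have "x \<in> pverts G" "y \<in> pverts G" using xy in_arcsD1 in_arcsD2 by auto
    ultimately have "v \<in> c" using Linj[OF uv(2)] by auto
    then have "(u, v) = (x, y) \<or> (u, v) = (y, x)" using c(2) xy(1) ne by auto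
    then show ?thesis using xy(2) pair_sym_arcs by (auto simp: symmetric_def sym_def)
  qed
  show ?thesis
  proof (rule multiplicity_le_1I[OF NC spec Llt[OF hdP]])
    fix X j
    assume ker: "\<And>i. i < 2 * p \<Longrightarrow> (\<Sum>j<2 * p. pencil p N l $$ (i, j) * X j) = 0"
      and X0: "X (L (hd P)) = 0" and j: "j < 2 * p"
    obtain v where v: "v \<in> pverts G" "j = L v" using bij j by (auto simp: bij_betw_def)
    \<comment> \<open>The pattern of \<open>N\<close> is only known in terms of vertices, so kernel vectors are pulled back along \<open>L\<close>.\<close>
    have "(\<lambda>v. X (L v)) v = 0"
    proof (rule caterpillar_kernel_vector[OF tree P dom, where H = "\<lambda>u v. pencil p N l $$ (L u, L v)"])
      fix u w assume uw: "u \<in> pverts G" "w \<in> pverts G" "u \<noteq> w"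
      have "(w, u) \<in> parcs G \<longleftrightarrow> (u, w) \<in> parcs G"
        using pair_sym_arcs by (auto simp: symmetric_def sym_def)
      then have "Omega p $$ (L u, L w) = 0" if "(u, w) \<notin> parcs G"
        using that matched uw Llt by (auto simp: Omega_index)
      then show "pencil p N l $$ (L u, L w) \<noteq> 0 \<longleftrightarrow> (u, w) \<in> parcs G"
        using pat[OF uw] Llt uw by (auto simp: pencil_def complex_eq_iff)
    next
      fix w assume "w \<in> pverts G - set P"
      then show "pencil p N l $$ (L w, L w) \<noteq> 0"
        using diag[of "L w"] Llt by (auto simp: pencil_def complex_eq_iff)
    next
      fix w assume w: "w \<in> pverts G"
      show "(\<Sum>u\<in>pverts G. pencil p N l $$ (L w, L u) * X (L u)) = 0"
        using sum.reindex_bij_betw[OF bij, of "\<lambda>j. pencil p N l $$ (L w, j) * X j"] ker[OF Llt[OF w]] by simp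
    qed (use X0 v in auto)
    then show "X j = 0" using v by simp
  qed
qed

lemma caterpillar_M_Sp:
  assumes cat: "caterpillar G" and M: "perfect_matching G M"
  shows "M_Sp (card M) G M = 1"
proof -
  let ?p = "card M"
  let ?A = "{count \<Lambda> x | L N \<Lambda> x. representative_labeling ?p G M L \<and> N \<in> S_plus ?p G L \<and>
           has_symplectic_spectrum ?p N \<Lambda> \<and> x \<in># \<Lambda>}"
  have pg: "pair_graph G" using cat by (simp add: caterpillar_def undirected_tree_def)
  note G = perfect_matching_coupling[OF pg M]
  obtain v where "v \<in> pverts G"
    using cat by (auto simp: caterpillar_def vpath_def vwalk_def neq_Nil_conv)
  then obtain e where "e \<in> M" using perfect_matching_covers[OF M] by blast
  then have p: "?p > 0" using coupling_card(2)[OF G] card_gt_0_iff by blast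
  define \<Lambda> where "\<Lambda> = mset (map (\<lambda>i. real (Suc i)) [0..<?p])"
  have dist: "distinct (map (\<lambda>i. real (Suc i)) [0..<?p])"
    by (auto simp: distinct_map inj_on_def)
  have "\<forall>x \<in># \<Lambda>. count \<Lambda> x = 1"
    using dist unfolding \<Lambda>_def distinct_count_atmost_1 by (metis set_mset_mset)
  then have "allows_symplectic_spectrum ?p G M \<Lambda>"
    by (intro coupled_graph_allows_distinct_spectrum[OF G]) (auto simp: \<Lambda>_def)
  moreover have "1 \<in># \<Lambda>" using p by (force simp: \<Lambda>_def)
  ultimately have ne: "?A \<noteq> {}"
    unfolding allows_symplectic_spectrum_def by blast
  have sub: "?A \<subseteq> {1}"
  proof safe
    fix L N \<Lambda> x
    assume LN: "representative_labeling ?p G M L" "N \<in> S_plus ?p G L"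
      "has_symplectic_spectrum ?p N \<Lambda>" and x: "x \<in># \<Lambda>"
    have "count \<Lambda> x \<le> 1" by (rule caterpillar_multiplicity_le_1[OF cat M LN])
    moreover have "1 \<le> count \<Lambda> x" using x by (rule count_greater_eq_one_iff[THEN iffD2])
    ultimately show "count \<Lambda> x = 1" by (rule le_antisym)
  qed
  have "?A = {1}" using subset_singletonD[OF sub] ne by iprover
  then show ?thesis unfolding M_Sp_def by (simp only: Max_singleton)
qed

theorem corollary6p20:
  shows "(\<forall>p (G :: 'v pair_pre_digraph) C.
            coupled_graph p G C \<and> M_Sp p G C = 1 \<longrightarrow>
            (\<forall>\<Lambda>. size \<Lambda> = p \<and> (\<forall>x \<in># \<Lambda>. x > 0) \<longrightarrow>
               (allows_symplectic_spectrum p G C \<Lambda> \<longleftrightarrow> (\<forall>x \<in># \<Lambda>. count \<Lambda> x = 1)))) \<and>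
         (\<forall>(G :: 'v pair_pre_digraph) M.
            caterpillar G \<and> perfect_matching G M \<longrightarrow>
            coupled_graph (card M) G M \<and> M_Sp (card M) G M = 1 \<and>
            (\<forall>\<Lambda>. size \<Lambda> = card M \<and> (\<forall>x \<in># \<Lambda>. x > 0) \<longrightarrow>
               (allows_symplectic_spectrum (card M) G M \<Lambda> \<longleftrightarrow> (\<forall>x \<in># \<Lambda>. count \<Lambda> x = 1))))"
proof (intro conjI allI impI)
  fix p and G :: "'v pair_pre_digraph" and C and \<Lambda> :: "real multiset"
  assume "coupled_graph p G C \<and> M_Sp p G C = 1" "size \<Lambda> = p \<and> (\<forall>x \<in># \<Lambda>. x > 0)"
  then show "allows_symplectic_spectrum p G C \<Lambda> \<longleftrightarrow> (\<forall>x \<in># \<Lambda>. count \<Lambda> x = 1)"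
    using allows_iff_distinct by blast
next
  fix G :: "'v pair_pre_digraph" and M
  assume cat: "caterpillar G \<and> perfect_matching G M"
  then show G: "coupled_graph (card M) G M"
    by (intro perfect_matching_coupling) (auto simp: caterpillar_def undirected_tree_def)
  show 1: "M_Sp (card M) G M = 1"
    using cat caterpillar_M_Sp by blast
  fix \<Lambda> :: "real multiset"
  assume "size \<Lambda> = card M \<and> (\<forall>x \<in># \<Lambda>. x > 0)"
  then show "allows_symplectic_spectrum (card M) G M \<Lambda> \<longleftrightarrow> (\<forall>x \<in># \<Lambda>. count \<Lambda> x = 1)"
    using allows_iff_distinct[OF G 1] by blast
qed

end
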